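(* Let $p,p'$ be relatively prime integers greater than $1$, let $a',b,b'$ be positive integers and let $c$ be a non-negative integer such that $a'>c$, $3b$ divides $p$, and $a'b'$ divides $p'$. Put $B=bb'$ and $n=\dfrac{pp'}{3a'bb'}$, and assume that $n$ is even. Let $\mathcal A_1^{(3)}$ be the set of pairs of integers $(r,s)$ with $0<r<p/b$, $0<s<p'/b'$ and $\dfrac{p'r/b'-ps/b-a'+3c}{6a'}\in\mathbb Z$, and let $\mathcal A_2^{(3)}$ be the set of pairs of integers $(r,s)$ with $0<r<p/b$, $0<s<p'/b'$ and $\dfrac{p'r/b'+ps/b+a'-3c}{6a'}\in\mathbb Z$. Define the integers $$f_{r,s}=\frac{p'r/b'-ps/b-a'+3c}{6a'}\ \text{ for }(r,s)\in\mathcal A_1^{(3)},\qquad f_{r,s}=\frac{-p'r/b'-ps/b-a'+3c}{6a'}\ \text{ for }(r,s)\in\mathcal A_2^{(3)}.$$ Then the following identities of formal power series in $q$ hold. (i) Let $p'/b'$ be even, or let $p/b$ be even and $c$ odd. Then $$\frac{(-q^{Bc},-q^{B(2a'-c)},q^{2Ba'};q^{2Ba'})_\infty(q^{2B(a'+c)},q^{2B(a'-c)};q^{4Ba'})_\infty}{(q^n;q^n)_\infty}=q^{\frac{(p-p')^2-(a'-3c)^2B^2}{12Ba'}}\Big(\sum_{(r,s)\in\mathcal A_1^{(3)}}(-1)^{f_{r,s}}\chi_{rb,sb'}^{(p,p')}(q^n)-\sum_{(r,s)\in\mathcal A_2^{(3)}}(-1)^{f_{r,s}}\chi_{rb,sb'}^{(p,p')}(q^n)\Big).$$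 (ii) Let $p'/b'$ be divisible by $4$, or let both $p/b$ and $c$ be divisible by $4$. Then $$\frac{(q^{Bc},-q^{B(2a'-c)},-q^{2Ba'};-q^{2Ba'})_\infty(-q^{2B(a'+c)},-q^{2B(a'-c)};q^{4Ba'})_\infty}{(q^n;q^n)_\infty}=q^{\frac{(p-p')^2-(a'-3c)^2B^2}{12Ba'}}\Big(\sum_{(r,s)\in\mathcal A_1^{(3)}}(-1)^{\frac{f_{r,s}(f_{r,s}-1)}{2}}\chi_{rb,sb'}^{(p,p')}(q^n)-\sum_{(r,s)\in\mathcal A_2^{(3)}}(-1)^{\frac{f_{r,s}(f_{r,s}-1)}{2}}\chi_{rb,sb'}^{(p,p')}(q^n)\Big).$$ (iii) Let $p'/b'$ be divisible by $4$, or let both $p/b$ and $c+2$ be divisible by $4$. Then $$\frac{(-q^{Bc},q^{B(2a'-c)},-q^{2Ba'};-q^{2Ba'})_\infty(-q^{2B(a'+c)},-q^{2B(a'-c)};q^{4Ba'})_\infty}{(q^n;q^n)_\infty}=q^{\frac{(p-p')^2-(a'-3c)^2B^2}{12Ba'}}\Big(\sum_{(r,s)\in\mathcal A_1^{(3)}}(-1)^{\frac{f_{r,s}(f_{r,s}+1)}{2}}\chi_{rb,sb'}^{(p,p')}(q^n)-\sum_{(r,s)\in\mathcal A_2^{(3)}}(-1)^{\frac{f_{r,s}(f_{r,s}+1)}{2}}\chi_{rb,sb'}^{(p,p')}(q^n)\Big).$$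
   Context: Notation: $(u_1,\dots,u_k;v)_\infty:=\prod_{i=0}^\infty\prod_{j=1}^k(1-u_jv^i)$ and $(q)_\infty=\prod_{j=1}^\infty(1-q^j)$. For relatively prime integers $p,p'>1$ and integers $1\le r\le p-1$, $1\le s\le p'-1$, $\chi_{r,s}^{(p,p')}(q)$ denotes the formal character $\mathrm{Tr}(q^{L_0})$ of the irreducible Virasoro module $M^{(p,p')}_{r,s}$ of the $(p,p')$ minimal series; it is given (Rocha-Caridi formula) by $$\chi_{r,s}^{(p,p')}(q)=\frac{q^{-\frac{(p'-p)^2}{4pp'}}}{(q)_\infty}\left(\sum_{j\in\mathbb Z}q^{\frac{(2pp'j+p'r-ps)^2}{4pp'}}-\sum_{j\in\mathbb Z}q^{\frac{(2pp'j+p'r+ps)^2}{4pp'}}\right),$$ which may be taken as its definition. It is a formal series in rational powers of $q$; $\chi(q^n)$ means that every exponent is multiplied by $n$. The sets $\mathcal A_1^{(3)}$ and $\mathcal A_2^{(3)}$ are disjoint, so $f_{r,s}$ is well defined.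
   Formalization: In (ii) and (iii) it is assumed in addition that n is divisible by 4 (automatic if 4 divides p/b); with only n even they fail, e.g. for p=3, p'=4, a'=2, b=b'=c=1 (n=2), where in (ii) the coefficient of q is -1 on the left and 1 on the right. *)

theory Defs
  imports "HOL-Analysis.Analysis"
begin

section \<open>Formal series in rational powers of an indeterminate\<close>

text \<open>
  A series is given by its coefficients, indexed by the rational exponents. Only finitely many
  exponents below any bound may occur, so that products are defined.
\<close>

typedef (overloaded) 'a rser = "{f :: rat \<Rightarrow> 'a::zero. \<forall>N. finite {e. e \<le> N \<and> f e \<noteq> 0}}"
  morphisms rcoeff Abs_rser
  by (rule exI[of _ "\<lambda>_. 0"]) simp

setup_lifting type_definition_rser

lemma rser_eqI: "(\<And>e. rcoeff f e = rcoeff g e) \<Longrightarrow> f = g"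
  by (simp add: rcoeff_inject[symmetric] fun_eq_iff)

lemma finite_rcoeff: "finite {e. e \<le> N \<and> rcoeff f e \<noteq> 0}"
  using rcoeff[of f] by auto

lemma rcoeff_lower_bound: "\<exists>m\<le>0. \<forall>e. rcoeff f e \<noteq> 0 \<longrightarrow> m \<le> e"
proof -
  let ?A = "insert 0 {e. e \<le> 0 \<and> rcoeff f e \<noteq> 0}"
  have fin: "finite ?A" using finite_rcoeff[of 0 f] by simp
  have "Min ?A \<le> e" if "rcoeff f e \<noteq> 0" for e
  proof (cases "e \<le> 0")
    case True
    then show ?thesis using that fin by (intro Min_le) auto
  next
    case False
    moreover have "Min ?A \<le> 0" using fin by (intro Min_le) auto
    ultimately show ?thesis by linarith
  qed
  moreover have "Min ?A \<le> 0" using fin by (intro Min_le) auto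
  ultimately show ?thesis by blast
qed

instantiation rser :: (comm_ring_1) comm_ring_1
begin

lift_definition zero_rser :: "'a rser" is "\<lambda>_. 0" by simp

lift_definition one_rser :: "'a rser" is "\<lambda>e. if e = 0 then 1 else 0"
  by (auto intro: finite_subset[of _ "{0}"])

lift_definition plus_rser :: "'a rser \<Rightarrow> 'a rser \<Rightarrow> 'a rser" is "\<lambda>f g e. f e + g e"
proof -
  fix f g :: "rat \<Rightarrow> 'a" and N :: rat
  assume "\<And>N. finite {e. e \<le> N \<and> f e \<noteq> 0}" "\<And>N. finite {e. e \<le> N \<and> g e \<noteq> 0}"
  then have "finite ({e. e \<le> N \<and> f e \<noteq> 0} \<union> {e. e \<le> N \<and> g e \<noteq> 0})" by blast
  then show "finite {e. e \<le> N \<and> f e + g e \<noteq> 0}" by (rule rev_finite_subset) auto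
qed

lift_definition uminus_rser :: "'a rser \<Rightarrow> 'a rser" is "\<lambda>f e. - f e" by simp

definition minus_rser :: "'a rser \<Rightarrow> 'a rser \<Rightarrow> 'a rser" where
  "minus_rser f g = f + - g"

definition times_rser :: "'a rser \<Rightarrow> 'a rser \<Rightarrow> 'a rser" where
  "times_rser f g = Abs_rser (\<lambda>e. \<Sum>x | rcoeff f x \<noteq> 0 \<and> rcoeff g (e - x) \<noteq> 0.
     rcoeff f x * rcoeff g (e - x))"

lemma rcoeff_times_raw:
  "rcoeff (f * g) e =
     (\<Sum>x | rcoeff f x \<noteq> 0 \<and> rcoeff g (e - x) \<noteq> 0. rcoeff f x * rcoeff g (e - x))"
proof -
  obtain m where m: "\<And>e. rcoeff f e \<noteq> 0 \<Longrightarrow> m \<le> e"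
    using rcoeff_lower_bound by metis
  obtain k where k: "\<And>e. rcoeff g e \<noteq> 0 \<Longrightarrow> k \<le> e"
    using rcoeff_lower_bound by metis
  let ?h = "\<lambda>e. \<Sum>x | rcoeff f x \<noteq> 0 \<and> rcoeff g (e - x) \<noteq> 0. rcoeff f x * rcoeff g (e - x)"
  have "finite {e. e \<le> N \<and> ?h e \<noteq> 0}" for N
  proof (rule finite_subset)
    let ?X = "{x. x \<le> N - k \<and> rcoeff f x \<noteq> 0}" and ?Y = "{y. y \<le> N - m \<and> rcoeff g y \<noteq> 0}"
    show "finite ((\<lambda>(x, y). x + y) ` (?X \<times> ?Y))"
      by (intro finite_imageI finite_cartesian_product finite_rcoeff)
    show "{e. e \<le> N \<and> ?h e \<noteq> 0} \<subseteq> (\<lambda>(x, y). x + y) ` (?X \<times> ?Y)"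
    proof
      fix e assume "e \<in> {e. e \<le> N \<and> ?h e \<noteq> 0}"
      then have e: "e \<le> N" "?h e \<noteq> 0" by auto
      from e(2) have "\<exists>x\<in>{x. rcoeff f x \<noteq> 0 \<and> rcoeff g (e - x) \<noteq> 0}.
          rcoeff f x * rcoeff g (e - x) \<noteq> 0"
        by (meson sum.not_neutral_contains_not_neutral)
      then obtain x where x: "rcoeff f x \<noteq> 0" "rcoeff g (e - x) \<noteq> 0" by blast
      have "x \<in> ?X" "e - x \<in> ?Y" using x m[OF x(1)] k[OF x(2)] e(1) by auto
      then have "(x, e - x) \<in> ?X \<times> ?Y" by blast
      then show "e \<in> (\<lambda>(x, y). x + y) ` (?X \<times> ?Y)" by (rule rev_image_eqI) simp
    qed
  qed
  then show ?thesis unfolding times_rser_def by (subst Abs_rser_inverse) auto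
qed

lemma rcoeff_times_sum:
  assumes "finite S" "finite T"
    and "\<And>x y. rcoeff f x \<noteq> 0 \<Longrightarrow> rcoeff g y \<noteq> 0 \<Longrightarrow> x + y = e \<Longrightarrow> x \<in> S \<and> y \<in> T"
  shows "rcoeff (f * g) e =
    (\<Sum>x\<in>S. \<Sum>y\<in>T. if x + y = e then rcoeff f x * rcoeff g y else 0)"
proof -
  have "(\<Sum>y\<in>T. if x + y = e then rcoeff f x * rcoeff g y else 0) =
      rcoeff f x * rcoeff g (e - x)" for x
  proof (cases "rcoeff f x = 0 \<or> rcoeff g (e - x) = 0")
    case True
    then show ?thesis by (auto intro!: sum.neutral simp: algebra_simps)
  next
    case False
    then have T: "e - x \<in> T" using assms(3)[of x "e - x"] by simp
    have "(\<Sum>y\<in>T. if x + y = e then rcoeff f x * rcoeff g y else 0) =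
        (\<Sum>y\<in>T. if y = e - x then rcoeff f x * rcoeff g y else 0)"
      by (intro sum.cong) (auto simp: algebra_simps)
    also have "\<dots> = rcoeff f x * rcoeff g (e - x)" using T assms(2) by simp
    finally show ?thesis .
  qed
  then have 1: "(\<Sum>x\<in>S. \<Sum>y\<in>T. if x + y = e then rcoeff f x * rcoeff g y else 0) =
      (\<Sum>x\<in>S. rcoeff f x * rcoeff g (e - x))" by simp
  have sub: "{x. rcoeff f x \<noteq> 0 \<and> rcoeff g (e - x) \<noteq> 0} \<subseteq> S"
  proof
    fix x assume "x \<in> {x. rcoeff f x \<noteq> 0 \<and> rcoeff g (e - x) \<noteq> 0}"
    then show "x \<in> S" using assms(3)[of x "e - x"] by simp
  qed
  have "rcoeff (f * g) e = (\<Sum>x\<in>S. rcoeff f x * rcoeff g (e - x))"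
    unfolding rcoeff_times_raw using assms(1) sub by (intro sum.mono_neutral_left) auto
  then show ?thesis by (simp only: 1)
qed

lemma rcoeff_times_triple:
  assumes m: "m \<le> 0" "\<And>e. rcoeff f e \<noteq> 0 \<Longrightarrow> m \<le> e" "\<And>e. rcoeff g e \<noteq> 0 \<Longrightarrow> m \<le> e"
    "\<And>e. rcoeff h e \<noteq> 0 \<Longrightarrow> m \<le> e"
    and "S = {x. x \<le> e - 2 * m \<and> rcoeff f x \<noteq> 0}"
    "T = {x. x \<le> e - 2 * m \<and> rcoeff g x \<noteq> 0}" "U = {x. x \<le> e - 2 * m \<and> rcoeff h x \<noteq> 0}"
  shows "rcoeff (f * (g * h)) e = (\<Sum>x\<in>S. \<Sum>y\<in>T. \<Sum>z\<in>U.
    if x + y + z = e then rcoeff f x * rcoeff g y * rcoeff h z else 0)"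
proof -
  have fin: "finite S" "finite T" "finite U" using assms(5-7) by (simp_all add: finite_rcoeff)
  define W where "W = (\<lambda>(y, z). y + z) ` (T \<times> U)"
  have finW: "finite W" using fin by (simp add: W_def)
  have gh: "rcoeff (g * h) w =
      (\<Sum>y\<in>T. \<Sum>z\<in>U. if y + z = w then rcoeff g y * rcoeff h z else 0)" if "w \<le> e - m" for w
  proof (rule rcoeff_times_sum[OF fin(2,3)])
    fix y z assume "rcoeff g y \<noteq> 0" "rcoeff h z \<noteq> 0" "y + z = w"
    then show "y \<in> T \<and> z \<in> U" using m(3)[of y] m(4)[of z] that assms(6,7) by auto
  qed
  have ghW: "w \<in> W" if "w \<le> e - m" "rcoeff (g * h) w \<noteq> 0" for w
  proof (rule ccontr)
    assume "w \<notin> W"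
    then have "\<And>y z. y \<in> T \<Longrightarrow> z \<in> U \<Longrightarrow> y + z \<noteq> w" by (force simp: W_def)
    then have "rcoeff (g * h) w = 0" unfolding gh[OF that(1)] by (intro sum.neutral ballI) auto
    with that(2) show False by simp
  qed
  have W2: "2 * m \<le> w" if "w \<in> W" for w
    using that m(3) m(4) assms(6,7) by (force simp: W_def)
  have gh2: "2 * m \<le> w" if "rcoeff (g * h) w \<noteq> 0" for w
  proof (cases "w \<le> e - m")
    case True then show ?thesis using ghW W2 that by blast
  next
    case False
    have "\<exists>y\<in>{y. rcoeff g y \<noteq> 0 \<and> rcoeff h (w - y) \<noteq> 0}. rcoeff g y * rcoeff h (w - y) \<noteq> 0"
      using that unfolding rcoeff_times_raw
      by (meson sum.not_neutral_contains_not_neutral)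
    then obtain y where "rcoeff g y \<noteq> 0" "rcoeff h (w - y) \<noteq> 0" by blast
    then show ?thesis using m(3)[of y] m(4)[of "w - y"] by simp
  qed
  have "rcoeff (f * (g * h)) e =
      (\<Sum>x\<in>S. \<Sum>w\<in>W. if x + w = e then rcoeff f x * rcoeff (g * h) w else 0)"
  proof (rule rcoeff_times_sum[OF fin(1) finW])
    fix x w assume *: "rcoeff f x \<noteq> 0" "rcoeff (g * h) w \<noteq> 0" "x + w = e"
    then show "x \<in> S \<and> w \<in> W" using m(2)[of x] gh2[of w] ghW[of w] assms(5) by auto
  qed
  also have "\<dots> = (\<Sum>x\<in>S. \<Sum>y\<in>T. \<Sum>z\<in>U.
    if x + y + z = e then rcoeff f x * rcoeff g y * rcoeff h z else 0)"
  proof (rule sum.cong[OF refl])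
    fix x assume x: "x \<in> S"
    have "(\<Sum>w\<in>W. if x + w = e then rcoeff f x * rcoeff (g * h) w else 0) =
      (\<Sum>w\<in>W. \<Sum>y\<in>T. \<Sum>z\<in>U.
         if y + z = w then (if x + w = e then rcoeff f x * rcoeff g y * rcoeff h z else 0) else 0)"
    proof (rule sum.cong[OF refl])
      fix w assume "w \<in> W"
      show "(if x + w = e then rcoeff f x * rcoeff (g * h) w else 0) = (\<Sum>y\<in>T. \<Sum>z\<in>U.
         if y + z = w then (if x + w = e then rcoeff f x * rcoeff g y * rcoeff h z else 0) else 0)"
      proof (cases "x + w = e")
        case True
        then have "w \<le> e - m" using x m(2)[of x] assms(5) by auto
        from gh[OF this] True show ?thesis
          by (simp add: sum_distrib_left mult.assoc if_distrib cong: if_cong)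
      qed (auto intro!: sum.neutral)
    qed
    also have "\<dots> = (\<Sum>y\<in>T. \<Sum>w\<in>W. \<Sum>z\<in>U.
         if y + z = w then (if x + w = e then rcoeff f x * rcoeff g y * rcoeff h z else 0) else 0)"
      by (rule sum.swap)
    also have "\<dots> = (\<Sum>y\<in>T. \<Sum>z\<in>U. \<Sum>w\<in>W.
         if y + z = w then (if x + w = e then rcoeff f x * rcoeff g y * rcoeff h z else 0) else 0)"
      by (intro sum.cong refl sum.swap)
    also have "\<dots> = (\<Sum>y\<in>T. \<Sum>z\<in>U.
        if x + y + z = e then rcoeff f x * rcoeff g y * rcoeff h z else 0)"
    proof (intro sum.cong refl)
      fix y z assume "y \<in> T" "z \<in> U"
      then have "y + z \<in> W" by (auto simp: W_def)
      then show "(\<Sum>w\<in>W. if y + z = w then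
          (if x + w = e then rcoeff f x * rcoeff g y * rcoeff h z else 0) else 0) =
        (if x + y + z = e then rcoeff f x * rcoeff g y * rcoeff h z else 0)"
        using finW by (simp add: add.assoc)
    qed
    finally show "(\<Sum>w\<in>W. if x + w = e then rcoeff f x * rcoeff (g * h) w else 0) =
      (\<Sum>y\<in>T. \<Sum>z\<in>U. if x + y + z = e then rcoeff f x * rcoeff g y * rcoeff h z else 0)" .
  qed
  finally show ?thesis .
qed

instance
proof
  fix f g h :: "'a rser"
  show comm: "f * g = g * f" for f g :: "'a rser"
  proof (rule rser_eqI)
    fix e
    show "rcoeff (f * g) e = rcoeff (g * f) e"
      unfolding rcoeff_times_raw
      by (rule sum.reindex_bij_witness[of _ "\<lambda>x. e - x" "\<lambda>x. e - x"]) (auto simp: mult.commute)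
  qed
  show "f * g * h = f * (g * h)"
  proof (rule rser_eqI)
    fix e
    obtain m1 where m1: "m1 \<le> 0" "\<And>e. rcoeff f e \<noteq> 0 \<Longrightarrow> m1 \<le> e" using rcoeff_lower_bound by metis
    obtain m2 where m2: "m2 \<le> 0" "\<And>e. rcoeff g e \<noteq> 0 \<Longrightarrow> m2 \<le> e" using rcoeff_lower_bound by metis
    obtain m3 where m3: "m3 \<le> 0" "\<And>e. rcoeff h e \<noteq> 0 \<Longrightarrow> m3 \<le> e" using rcoeff_lower_bound by metis
    define m where "m = min m1 (min m2 m3)"
    have m: "m \<le> 0" "\<And>e. rcoeff f e \<noteq> 0 \<Longrightarrow> m \<le> e" "\<And>e. rcoeff g e \<noteq> 0 \<Longrightarrow> m \<le> e"
      "\<And>e. rcoeff h e \<noteq> 0 \<Longrightarrow> m \<le> e"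
      using m1 m2 m3 by (force simp: m_def)+
    let ?S = "{x. x \<le> e - 2 * m \<and> rcoeff f x \<noteq> 0}"
    let ?T = "{x. x \<le> e - 2 * m \<and> rcoeff g x \<noteq> 0}"
    let ?U = "{x. x \<le> e - 2 * m \<and> rcoeff h x \<noteq> 0}"
    have "rcoeff (f * g * h) e = rcoeff (h * (f * g)) e" by (simp add: comm)
    also have "\<dots> = (\<Sum>z\<in>?U. \<Sum>x\<in>?S. \<Sum>y\<in>?T.
        if z + x + y = e then rcoeff h z * rcoeff f x * rcoeff g y else 0)"
      by (rule rcoeff_times_triple[OF m(1,4,2,3)]) auto
    also have "\<dots> = (\<Sum>x\<in>?S. \<Sum>z\<in>?U. \<Sum>y\<in>?T.
        if z + x + y = e then rcoeff h z * rcoeff f x * rcoeff g y else 0)"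
      by (rule sum.swap)
    also have "\<dots> = (\<Sum>x\<in>?S. \<Sum>y\<in>?T. \<Sum>z\<in>?U.
        if z + x + y = e then rcoeff h z * rcoeff f x * rcoeff g y else 0)"
      by (intro sum.cong refl sum.swap)
    also have "\<dots> = (\<Sum>x\<in>?S. \<Sum>y\<in>?T. \<Sum>z\<in>?U.
        if x + y + z = e then rcoeff f x * rcoeff g y * rcoeff h z else 0)"
      by (intro sum.cong refl) (simp add: ac_simps)
    also have "\<dots> = rcoeff (f * (g * h)) e"
      by (rule rcoeff_times_triple[OF m, symmetric]) auto
    finally show "rcoeff (f * g * h) e = rcoeff (f * (g * h)) e" .
  qed
  show "1 * f = f"
  proof (rule rser_eqI)
    fix e
    have "rcoeff (1 * f) e = (\<Sum>x\<in>{0}. \<Sum>y\<in>{e}. if x + y = e then rcoeff 1 x * rcoeff f y else 0)"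
      by (rule rcoeff_times_sum) (auto simp: one_rser.rep_eq split: if_splits)
    then show "rcoeff (1 * f) e = rcoeff f e" by (simp add: one_rser.rep_eq)
  qed
  show "(f + g) * h = f * h + g * h"
  proof (rule rser_eqI)
    fix e
    obtain m where m: "\<And>e. rcoeff h e \<noteq> 0 \<Longrightarrow> m \<le> e" using rcoeff_lower_bound by metis
    obtain k1 where k1: "\<And>e. rcoeff f e \<noteq> 0 \<Longrightarrow> k1 \<le> e" using rcoeff_lower_bound by metis
    obtain k2 where k2: "\<And>e. rcoeff g e \<noteq> 0 \<Longrightarrow> k2 \<le> e" using rcoeff_lower_bound by metis
    define k where "k = min k1 k2"
    let ?S = "{x. x \<le> e - m \<and> rcoeff f x \<noteq> 0} \<union> {x. x \<le> e - m \<and> rcoeff g x \<noteq> 0}"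
    let ?T = "{y. y \<le> e - k \<and> rcoeff h y \<noteq> 0}"
    have fin: "finite ?S" "finite ?T" by (auto simp: finite_rcoeff)
    have mem: "x \<in> ?S \<and> y \<in> ?T"
      if "rcoeff f x \<noteq> 0 \<or> rcoeff g x \<noteq> 0" "rcoeff h y \<noteq> 0" "x + y = e" for x y
      using that m[of y] k1[of x] k2[of x] by (auto simp: k_def min_def)
    have "rcoeff ((f + g) * h) e =
        (\<Sum>x\<in>?S. \<Sum>y\<in>?T. if x + y = e then rcoeff (f + g) x * rcoeff h y else 0)"
      by (rule rcoeff_times_sum[OF fin]) (rule mem, auto simp: plus_rser.rep_eq)
    also have "\<dots> = (\<Sum>x\<in>?S. \<Sum>y\<in>?T. if x + y = e then rcoeff f x * rcoeff h y else 0)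
        + (\<Sum>x\<in>?S. \<Sum>y\<in>?T. if x + y = e then rcoeff g x * rcoeff h y else 0)"
      unfolding sum.distrib[symmetric]
      by (intro sum.cong refl) (auto simp: plus_rser.rep_eq algebra_simps)
    also have "\<dots> = rcoeff (f * h) e + rcoeff (g * h) e"
      by (subst (1 2) rcoeff_times_sum[OF fin]) (use mem in blast)+
    finally show "rcoeff ((f + g) * h) e = rcoeff (f * h + g * h) e"
      by (simp add: plus_rser.rep_eq)
  qed
  show "(0 :: 'a rser) \<noteq> 1"
    by (metis one_rser.rep_eq zero_rser.rep_eq zero_neq_one)
qed (auto intro!: rser_eqI
      simp: plus_rser.rep_eq zero_rser.rep_eq uminus_rser.rep_eq minus_rser_def algebra_simps)

end

lift_definition rconst :: "'a::comm_ring_1 \<Rightarrow> 'a rser" is "\<lambda>c e. if e = 0 then c else 0"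
  by (auto intro: finite_subset[of _ "{0}"])

text \<open>The monomial with exponent \<open>a\<close>.\<close>

lift_definition qpow :: "rat \<Rightarrow> 'a::comm_ring_1 rser" is "\<lambda>a e. if e = a then 1 else 0"
proof -
  fix a N :: rat
  show "finite {e. e \<le> N \<and> (if e = a then 1 else (0::'a)) \<noteq> 0}"
    by (rule finite_subset[of _ "{a}"]) auto
qed

lift_definition rser_of_fps :: "'a::comm_ring_1 fps \<Rightarrow> 'a rser" is
  "\<lambda>F e. if e \<in> \<nat> then fps_nth F (nat \<lfloor>e\<rfloor>) else 0"
proof -
  fix F :: "'a fps" and N :: rat
  show "finite {e. e \<le> N \<and> (if e \<in> \<nat> then fps_nth F (nat \<lfloor>e\<rfloor>) else 0) \<noteq> 0}"
  proof (rule finite_subset)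
    show "finite ((of_nat :: nat \<Rightarrow> rat) ` {..nat \<lfloor>N\<rfloor>})" by simp
    show "{e. e \<le> N \<and> (if e \<in> \<nat> then fps_nth F (nat \<lfloor>e\<rfloor>) else 0) \<noteq> 0}
        \<subseteq> (of_nat :: nat \<Rightarrow> rat) ` {..nat \<lfloor>N\<rfloor>}"
      by (auto elim!: Nats_cases split: if_splits simp: le_nat_iff le_floor_iff)
  qed
qed

text \<open>
  The substitution of \<open>q ^ n\<close> for \<open>q\<close>, which makes sense for \<open>n > 0\<close> only: all exponents are
  multiplied by \<open>n\<close>.
\<close>

lift_definition rser_subst_pow :: "nat \<Rightarrow> 'a::comm_ring_1 rser \<Rightarrow> 'a rser" is
  "\<lambda>n f e. if n > 0 then f (e / of_nat n) else 0"
proof -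
  fix n :: nat and f :: "rat \<Rightarrow> 'a" and N :: rat
  assume f: "\<And>N. finite {e. e \<le> N \<and> f e \<noteq> 0}"
  show "finite {e. e \<le> N \<and> (if n > 0 then f (e / of_nat n) else 0) \<noteq> 0}"
  proof (rule finite_subset)
    show "finite ((\<lambda>e. of_nat n * e) ` {e. e \<le> N / of_nat n \<and> f e \<noteq> 0})" using f by blast
    show "{e. e \<le> N \<and> (if n > 0 then f (e / of_nat n) else 0) \<noteq> 0}
        \<subseteq> (\<lambda>e. of_nat n * e) ` {e. e \<le> N / of_nat n \<and> f e \<noteq> 0}"
    proof
      fix e assume "e \<in> {e. e \<le> N \<and> (if n > 0 then f (e / of_nat n) else 0) \<noteq> 0}"
      then have "n > 0" "e \<le> N" "f (e / of_nat n) \<noteq> 0" by (auto split: if_splits)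
      then show "e \<in> (\<lambda>e. of_nat n * e) ` {e. e \<le> N / of_nat n \<and> f e \<noteq> 0}"
        by (intro image_eqI[of _ _ "e / of_nat n"]) (auto simp: divide_right_mono)
    qed
  qed
qed

text \<open>
  The infinite sum of the monomials with exponents \<open>\<phi> j\<close>, where \<open>j\<close> ranges over the integers.
  The coefficient at \<open>e\<close> counts the \<open>j\<close> with \<open>\<phi> j = e\<close>, which is legitimate if
  \<open>\<phi> j \<le> N\<close> for only finitely many \<open>j\<close>, as \<open>finite_theta_exponents\<close> below
  guarantees for the sums in the character formula.
\<close>

definition theta_sum :: "(int \<Rightarrow> rat) \<Rightarrow> 'a::comm_ring_1 rser" where
  "theta_sum \<phi> = Abs_rser (\<lambda>e. of_nat (card {j. \<phi> j = e}))"

lemma rcoeff_theta_sum: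
  assumes "\<And>N. finite {j. \<phi> j \<le> N}"
  shows "rcoeff (theta_sum \<phi> :: 'a::comm_ring_1 rser) e = of_nat (card {j. \<phi> j = e})"
proof -
  have "finite {e. e \<le> N \<and> (of_nat (card {j. \<phi> j = e}) :: 'a) \<noteq> 0}" for N
  proof (rule finite_subset)
    show "finite (\<phi> ` {j. \<phi> j \<le> N})" using assms by simp
    show "{e. e \<le> N \<and> (of_nat (card {j. \<phi> j = e}) :: 'a) \<noteq> 0} \<subseteq> \<phi> ` {j. \<phi> j \<le> N}"
    proof
      fix e assume "e \<in> {e. e \<le> N \<and> (of_nat (card {j. \<phi> j = e}) :: 'a) \<noteq> 0}"
      then have "e \<le> N" and nz: "(of_nat (card {j. \<phi> j = e}) :: 'a) \<noteq> 0" by auto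
      from nz have "{j. \<phi> j = e} \<noteq> {}" by (metis card.empty of_nat_0)
      with \<open>e \<le> N\<close> have "e \<le> N" "{j. \<phi> j = e} \<noteq> {}" by auto
      then show "e \<in> \<phi> ` {j. \<phi> j \<le> N}" by blast
    qed
  qed
  then show ?thesis unfolding theta_sum_def by (subst Abs_rser_inverse) auto
qed

lemma finite_theta_exponents:
  fixes a d :: nat and k :: int
  assumes "a > 0" "d > 0"
  shows "finite {j :: int. of_int ((int a * j + k)\<^sup>2) / of_nat d \<le> (N :: rat)}"
proof (rule finite_subset)
  define M where "M = nat \<lfloor>N * of_nat d\<rfloor>"
  let ?B = "int M + \<bar>k\<bar> + 1"
  show "finite {- ?B..?B}" by simp
  show "{j :: int. of_int ((int a * j + k)\<^sup>2) / of_nat d \<le> N} \<subseteq> {- ?B..?B}"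
  proof
    fix j :: int assume "j \<in> {j. of_int ((int a * j + k)\<^sup>2) / of_nat d \<le> N}"
    then have "of_int ((int a * j + k)\<^sup>2) \<le> N * of_nat d"
      using assms by (simp add: pos_divide_le_eq del: of_int_power)
    then have "(int a * j + k)\<^sup>2 \<le> \<lfloor>N * of_nat d\<rfloor>" by (simp only: le_floor_iff)
    then have "(int a * j + k)\<^sup>2 \<le> int M" unfolding M_def by linarith
    moreover have "\<bar>x\<bar> \<le> x\<^sup>2" for x :: int
    proof (cases "x = 0")
      case False
      then have "\<bar>x\<bar> * 1 \<le> \<bar>x\<bar> * \<bar>x\<bar>" by (intro mult_left_mono) auto
      then show ?thesis by (simp add: power2_eq_square)
    qed simp
    then have "\<bar>int a * j + k\<bar> \<le> (int a * j + k)\<^sup>2" .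
    ultimately have "\<bar>int a * j + k\<bar> \<le> int M" by linarith
    then have "\<bar>int a * j\<bar> \<le> int M + \<bar>k\<bar>" by linarith
    moreover have "\<bar>j\<bar> * 1 \<le> \<bar>j\<bar> * int a" using assms by (intro mult_left_mono) auto
    ultimately have "\<bar>j\<bar> \<le> int M + \<bar>k\<bar>" by (simp add: abs_mult mult.commute)
    then show "j \<in> {- ?B..?B}" by auto
  qed
qed


section \<open>Infinite products and minimal series characters\<close>

text \<open>
  \<open>qpoch [u\<^sub>1, \<dots>, u\<^sub>k] v\<close> is the product of the factors \<open>1 - u\<^sub>j * v ^ i\<close> over all
  \<open>i \<ge> 0\<close> and \<open>1 \<le> j \<le> k\<close>, taken in the topology of the ring of formal power series.
\<close>

definition qpoch :: "'a::comm_ring_1 fps list \<Rightarrow> 'a fps \<Rightarrow> 'a fps" where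
  "qpoch us v = (\<Prod>i. \<Prod>u\<leftarrow>us. 1 - u * v ^ i)"

text \<open>
  The character of the irreducible Virasoro module with labels \<open>r, s\<close> in the \<open>(p, p')\<close> minimal
  series, by the Rocha-Caridi formula.
\<close>

definition minimal_character :: "nat \<Rightarrow> nat \<Rightarrow> int \<Rightarrow> int \<Rightarrow> rat rser" where
  "minimal_character p p' r s =
     qpow (- (of_int ((int p' - int p)\<^sup>2) / of_nat (4 * p * p')))
     * rser_of_fps (inverse (qpoch [fps_X] fps_X))
     * (theta_sum (\<lambda>j. of_int ((2 * int p * int p' * j + int p' * r - int p * s)\<^sup>2) / of_nat (4 * p * p'))
        - theta_sum (\<lambda>j. of_int ((2 * int p * int p' * j + int p' * r + int p * s)\<^sup>2) / of_nat (4 * p * p')))"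


section \<open>The index sets and the exponents of the signs\<close>

text \<open>
  In the following \<open>b\<close> divides \<open>p\<close> and \<open>b'\<close> divides \<open>p'\<close>, so that the quotients \<open>p div b\<close>
  and \<open>p' div b'\<close> are exact, as are the divisions by \<open>6 * a'\<close> on the two index sets.
\<close>

definition A1 :: "nat \<Rightarrow> nat \<Rightarrow> nat \<Rightarrow> nat \<Rightarrow> nat \<Rightarrow> nat \<Rightarrow> (int \<times> int) set" where
  "A1 p p' a' b b' c = {(r, s). 0 < r \<and> r < int (p div b) \<and> 0 < s \<and> s < int (p' div b') \<and>
     6 * int a' dvd int (p' div b') * r - int (p div b) * s - int a' + 3 * int c}"

definition A2 :: "nat \<Rightarrow> nat \<Rightarrow> nat \<Rightarrow> nat \<Rightarrow> nat \<Rightarrow> nat \<Rightarrow> (int \<times> int) set" where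
  "A2 p p' a' b b' c = {(r, s). 0 < r \<and> r < int (p div b) \<and> 0 < s \<and> s < int (p' div b') \<and>
     6 * int a' dvd int (p' div b') * r + int (p div b) * s + int a' - 3 * int c}"

definition sign_exp :: "nat \<Rightarrow> nat \<Rightarrow> nat \<Rightarrow> nat \<Rightarrow> nat \<Rightarrow> nat \<Rightarrow> int \<times> int \<Rightarrow> int" where
  "sign_exp p p' a' b b' c = (\<lambda>(r, s).
     if (r, s) \<in> A1 p p' a' b b' c
     then (int (p' div b') * r - int (p div b) * s - int a' + 3 * int c) div (6 * int a')
     else (- int (p' div b') * r - int (p div b) * s - int a' + 3 * int c) div (6 * int a'))"

text \<open>
  The right-hand side of the identities, for signs \<open>(-1) powi \<sigma> f\<close>; the exponents
  \<open>\<sigma> f\<close> can be negative.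

  Replacing \<open>j\<close> by \<open>j + 1\<close> in the character formula changes \<open>f\<close> by \<open>n\<close>, so the signs have to
  be periodic modulo \<open>n\<close> in \<open>f\<close>. For \<open>\<sigma> f = f\<close> this holds if \<open>n\<close> is even, but for
  \<open>\<sigma> f = f * (f - 1) div 2\<close> and \<open>\<sigma> f = f * (f + 1) div 2\<close> only if 4 divides \<open>n\<close>. The paper
  assumes just that \<open>n\<close> is even, under which the latter two identities can fail: for
  \<open>p = 3\<close>, \<open>p' = 4\<close>, \<open>a' = 2\<close>, \<open>b = b' = c = 1\<close> we have \<open>n = 2\<close>, and in the second
  identity the coefficient of \<open>q\<close> is \<open>-1\<close> on the left and \<open>1\<close> on the right. They are therefore
  stated with the additional hypothesis \<open>4 dvd n\<close>, which is automatic in the cases where 4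
  divides \<open>p div b\<close>.
\<close>

definition character_sum ::
    "(int \<Rightarrow> int) \<Rightarrow> nat \<Rightarrow> nat \<Rightarrow> nat \<Rightarrow> nat \<Rightarrow> nat \<Rightarrow> nat \<Rightarrow> nat \<Rightarrow> rat rser" where
  "character_sum \<sigma> n p p' a' b b' c =
     qpow (of_int ((int p - int p')\<^sup>2 - (int a' - 3 * int c)\<^sup>2 * (int (b * b'))\<^sup>2)
           / of_nat (12 * (b * b') * a'))
     * ((\<Sum>(r, s)\<in>A1 p p' a' b b' c. rconst ((- 1) powi \<sigma> (sign_exp p p' a' b b' c (r, s)))
           * rser_subst_pow n (minimal_character p p' (r * int b) (s * int b')))
        - (\<Sum>(r, s)\<in>A2 p p' a' b b' c. rconst ((- 1) powi \<sigma> (sign_exp p p' a' b b' c (r, s)))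
           * rser_subst_pow n (minimal_character p p' (r * int b) (s * int b'))))"

lemma finite_A1: "finite (A1 p p' a' b b' c)"
  by (rule finite_subset[of _ "{0..int (p div b)} \<times> {0..int (p' div b')}"]) (auto simp: A1_def)

lemma finite_A2: "finite (A2 p p' a' b b' c)"
  by (rule finite_subset[of _ "{0..int (p div b)} \<times> {0..int (p' div b')}"]) (auto simp: A2_def)

end

theory Submission
  imports Defs
begin

text \<open>
  Put \<open>P = p div b\<close>, \<open>P' = p' div b'\<close>, and let \<open>\<delta>\<close> be the constant exponent
  \<open>- B (a' - 3 c)\<^sup>2 / (12 a')\<close>. Both sides of each identity are
  \<open>1 / (q\<^sup>n; q\<^sup>n)\<^sub>\<infinity>\<close> times a signed sum of powers \<open>q\<^sup>\<delta> q\<^bsup>B x\<^sup>2 / (12 a')\<^esup>\<close> over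
  integers \<open>x\<close>, and the proof matches the two sums.

  On the left, the product is Watson's quintuple product in base \<open>Q = \<plusminus> q\<^bsup>2 B a'\<^esup>\<close> with argument
  \<open>z = \<plusminus> q\<^bsup>B c\<^esup>\<close>. Completing the square in the exponents of its expansion gives the
  \<open>x = 6 a' k + a' - 3 c\<close> with a sign \<open>\<epsilon> k\<close> and the \<open>x = 6 a' k + a' + 3 c\<close> with a sign \<open>\<epsilon>' k\<close>.
  The quintuple product is obtained by multiplying two Jacobi triple products and sorting the
  terms of the double sum by a residue modulo 3: one class cancels, and in the two others
  Euler's pentagonal series factors out (\<open>quintuple_product\<close>). The triple product is in turn the
  limit of the finite version with Gauss binomial coefficients (\<open>jacobi_triple_product\<close>).

  On the right, after the prefactors of the characters are absorbed into \<open>q\<^sup>\<delta>\<close>, the label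
  \<open>(r, s)\<close> contributes the \<open>x\<close> congruent to \<open>P' r - P s\<close> and, with the opposite sign, those
  congruent to \<open>P' r + P s\<close> modulo \<open>2 P P'\<close>. By the Chinese remainder theorem every
  integer divisible by neither \<open>P\<close> nor \<open>P'\<close> is congruent to \<open>P' r - P s\<close> or to
  \<open>- P' r - P s\<close> modulo \<open>2 P P'\<close> for exactly one label (\<open>sum_over_coprime_residues\<close>). The two
  index sets pick the labels for which \<open>P' r - P s\<close> or \<open>- P' r - P s\<close>, respectively, has the form
  \<open>6 a' k + a' - 3 c\<close>; the modulus \<open>2 P P' = 6 a' n\<close> shifts \<open>k\<close> by \<open>n\<close>. As \<open>3\<close> divides \<open>P\<close> and
  \<open>a'\<close> divides \<open>P'\<close>, reversing the sign of \<open>P s\<close> turns such an integer into one of the form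
  \<open>6 a' (k + t) + a' + 3 c\<close>. So the sums agree if \<open>\<epsilon>' (k + t) = - \<epsilon> k\<close> for these \<open>t\<close>, if the
  signs have period \<open>n\<close>, and if the multiples of \<open>P\<close> or \<open>P'\<close> contribute nothing
  on the left (\<open>signed_exponent_count\<close>). These conditions on the signs are what the parity
  assumptions of the three identities provide.
\<close>

unbundle fps_syntax
unbundle no vec_syntax

section \<open>Agreement of power series up to a given order\<close>

text \<open>
  Limits of power series are handled by comparing coefficients below a given order; agreement
  to all orders is equality.
\<close>

definition agree :: "nat \<Rightarrow> 'a::comm_ring_1 fps \<Rightarrow> 'a fps \<Rightarrow> bool" where
  "agree N F G \<longleftrightarrow> (\<forall>i<N. F $ i = G $ i)"

lemma agree_refl [simp]: "agree N F F"
  by (simp add: agree_def)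

lemma agree_sym: "agree N F G \<Longrightarrow> agree N G F"
  by (simp add: agree_def)

lemma agree_trans [trans]: "agree N F G \<Longrightarrow> agree N G H \<Longrightarrow> agree N F H"
  by (simp add: agree_def)

lemma agree_mono: "agree N F G \<Longrightarrow> M \<le> N \<Longrightarrow> agree M F G"
  by (simp add: agree_def)

lemma agree_all_imp_eq: "(\<And>N. agree N F G) \<Longrightarrow> F = G"
  by (auto simp: agree_def fps_eq_iff)

lemma agree_mult: "agree N F G \<Longrightarrow> agree N F' G' \<Longrightarrow> agree N (F * F') (G * G')"
  by (auto simp: agree_def fps_mult_nth intro!: sum.cong)

lemma agree_diff: "agree N F G \<Longrightarrow> agree N F' G' \<Longrightarrow> agree N (F - F') (G - G')"
  by (simp add: agree_def)

lemma agree_sum: "(\<And>i. i \<in> A \<Longrightarrow> agree N (F i) (G i)) \<Longrightarrow> agree N (sum F A) (sum G A)"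
  by (auto simp: agree_def fps_sum_nth intro!: sum.cong)

lemma agree_prod_list:
  "(\<And>u. u \<in> set us \<Longrightarrow> agree N (F u) (G u)) \<Longrightarrow> agree N (\<Prod>u\<leftarrow>us. F u) (\<Prod>u\<leftarrow>us. G u)"
  by (induction us) (auto intro!: agree_mult)

lemma agree_cancel_unit:
  fixes F G E :: "'a::field fps"
  assumes "agree N (F * E) (G * E)" and "E $ 0 \<noteq> 0"
  shows "agree N F G"
proof -
  have "agree N (F * E * inverse E) (G * E * inverse E)"
    using assms(1) by (rule agree_mult) simp
  moreover have "E * inverse E = 1"
    using assms(2) by (rule inverse_mult_eq_1')
  ultimately show ?thesis by (simp add: mult.assoc)
qed

lemma agree_power_mult_zero:
  fixes Q :: "'a::comm_ring_1 fps"
  assumes "Q $ 0 = 0" and "N \<le> L"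
  shows "agree N (Q ^ L * G) 0"
proof -
  have "(Q ^ L) $ i = 0" if "i < N" for i
    using assms that by (intro startsby_zero_power_prefix[rule_format]) auto
  then show ?thesis by (auto simp: agree_def fps_mult_nth intro!: sum.neutral)
qed

section \<open>Infinite products of power series\<close>

lemma agree_prod_lessThan:
  fixes f :: "nat \<Rightarrow> 'a::comm_ring_1 fps"
  assumes f: "\<And>i. agree i (f i) 1" and "N \<le> n"
  shows "agree N (\<Prod>i<n. f (i + M)) (\<Prod>i<N. f (i + M))"
  using assms(2)
proof (induction n rule: dec_induct)
  case (step n)
  have "agree N (f (n + M)) 1"
    by (rule agree_mono[OF f]) (use step(1) in simp)
  with step(3) have "agree N ((\<Prod>i<n. f (i + M)) * f (n + M)) ((\<Prod>i<N. f (i + M)) * 1)"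
    by (rule agree_mult)
  then show ?case by simp
qed simp

text \<open>
  The factor with index 0 is arbitrary and may vanish, as it does for \<open>c = 0\<close> in one of the
  products below. The partial products that start at index 1 stabilize in every coefficient, and
  their limit has the constant coefficient 1, so it is nonzero, as \<open>has_prod\<close> demands.
\<close>

lemma agree_prodinf:
  fixes f :: "nat \<Rightarrow> 'a::idom fps"
  assumes f: "\<And>i. agree i (f i) 1"
  shows "agree N (prodinf f) (\<Prod>i<N. f i)"
proof -
  define p where "p M = Abs_fps (\<lambda>m. (\<Prod>i<Suc m. f (i + M)) $ m)" for M
  have p: "agree N (p M) (\<Prod>i<N. f (i + M))" for N M
  proof -
    have "(\<Prod>i<Suc m. f (i + M)) $ m = (\<Prod>i<N. f (i + M)) $ m" if "m < N" for m
      using agree_prod_lessThan[OF f, of "Suc m" N M] that by (simp add: agree_def del: prod.lessThan_Suc)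
    then show ?thesis by (simp add: agree_def p_def del: prod.lessThan_Suc)
  qed
  have lim: "(\<lambda>n. \<Prod>i\<le>n. f (i + M)) \<longlonglongrightarrow> p M" for M
  proof (rule tendsto_fpsI)
    fix m
    have "(\<Prod>i\<le>n. f (i + M)) $ m = p M $ m" if "n \<ge> m" for n
      using p[of "Suc n" M] that by (simp add: agree_def lessThan_Suc_atMost)
    then show "\<forall>\<^sub>F n in sequentially. (\<Prod>i\<le>n. f (i + M)) $ m = p M $ m"
      by (auto simp: eventually_sequentially)
  qed
  have "p 1 $ 0 = 1" using f[of 1] by (simp add: p_def agree_def)
  then have p1: "p 1 \<noteq> 0" by auto
  have p0: "p 0 = f 0 * p 1"
  proof (rule agree_all_imp_eq)
    fix N
    have "agree N (p 0) (\<Prod>i<Suc N. f i)"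
      using p[of "Suc N" 0] by (auto intro: agree_mono)
    also have "(\<Prod>i<Suc N. f i) = f 0 * (\<Prod>i<N. f (i + 1))"
      by (subst prod.lessThan_Suc_shift) simp
    also have "agree N \<dots> (f 0 * p 1)"
      by (intro agree_mult agree_refl agree_sym[OF p])
    finally show "agree N (p 0) (f 0 * p 1)" .
  qed
  have "f has_prod p 0"
  proof (cases "f 0 = 0")
    case True
    with p0 have "p 0 = 0" by simp
    moreover have "raw_has_prod f (Suc 0) (p 1)"
      using lim[of 1] p1 by (simp add: raw_has_prod_def)
    ultimately show ?thesis using True unfolding has_prod_def by blast
  next
    case False
    with lim[of 0] p1 p0 show ?thesis unfolding has_prod_def raw_has_prod_def by simp
  qed
  then have "prodinf f = p 0" by (rule has_prod_unique[symmetric])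
  with p[of N 0] show ?thesis by simp
qed

lemma agree_qpoch:
  fixes v :: "'a::idom fps"
  assumes "v $ 0 = 0"
  shows "agree N (qpoch us v) (\<Prod>i<N. \<Prod>u\<leftarrow>us. 1 - u * v ^ i)"
  unfolding qpoch_def
proof (rule agree_prodinf)
  fix i
  have "agree i (1 - u * v ^ i) (1 - 0)" for u
    using agree_power_mult_zero[OF assms order.refl, of i u]
    by (intro agree_diff agree_refl) (simp add: mult.commute)
  then have "agree i (\<Prod>u\<leftarrow>us. 1 - u * v ^ i) (\<Prod>u\<leftarrow>us. 1)"
    by (intro agree_prod_list) simp
  also have "(\<Prod>u\<leftarrow>us. 1) = (1 :: 'a fps)"
    by (induction us) auto
  finally show "agree i (\<Prod>u\<leftarrow>us. 1 - u * v ^ i) 1" .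
qed

lemma qpoch_Cons:
  fixes v :: "'a::idom fps"
  assumes "v $ 0 = 0"
  shows "qpoch (u # us) v = qpoch [u] v * qpoch us v"
proof (rule agree_all_imp_eq)
  fix N
  have "agree N (qpoch (u # us) v) (\<Prod>i<N. \<Prod>u\<leftarrow>u # us. 1 - u * v ^ i)"
    by (rule agree_qpoch[OF assms])
  also have "(\<Prod>i<N. \<Prod>u\<leftarrow>u # us. 1 - u * v ^ i) =
      (\<Prod>i<N. \<Prod>u\<leftarrow>[u]. 1 - u * v ^ i) * (\<Prod>i<N. \<Prod>u\<leftarrow>us. 1 - u * v ^ i)"
    by (simp add: prod.distrib)
  also have "agree N \<dots> (qpoch [u] v * qpoch us v)"
    by (intro agree_mult agree_sym[OF agree_qpoch[OF assms]])
  finally show "agree N (qpoch (u # us) v) (qpoch [u] v * qpoch us v)" .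
qed

text \<open>
  The exponents \<open>1, 2, 3, \<dots>\<close> are sorted by their residues modulo 3.
\<close>

lemma qpoch_trisect:
  fixes q :: "'a::idom fps"
  assumes "q $ 0 = 0"
  shows "qpoch [q, q\<^sup>2, q ^ 3] (q ^ 3) = qpoch [q] q"
proof (rule agree_all_imp_eq)
  fix N
  have q3: "(q ^ 3) $ 0 = 0" using assms by simp
  have "agree N (qpoch [q, q\<^sup>2, q ^ 3] (q ^ 3))
      (\<Prod>i<N. \<Prod>u\<leftarrow>[q, q\<^sup>2, q ^ 3]. 1 - u * (q ^ 3) ^ i)"
    by (rule agree_qpoch[OF q3])
  also have "(\<Prod>i<N. \<Prod>u\<leftarrow>[q, q\<^sup>2, q ^ 3]. 1 - u * (q ^ 3) ^ i) = (\<Prod>i<3 * N. 1 - q * q ^ i)"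
  proof (induction N)
    case (Suc N)
    have "3 * Suc N = Suc (Suc (Suc (3 * N)))" by simp
    moreover have "(\<Prod>u\<leftarrow>[q, q\<^sup>2, q ^ 3]. 1 - u * (q ^ 3) ^ N) =
        (1 - q * q ^ (3 * N)) * (1 - q * q ^ Suc (3 * N)) * (1 - q * q ^ Suc (Suc (3 * N)))"
      by (simp add: power_mult power2_eq_square power3_eq_cube mult.assoc)
    ultimately show ?case
      by (simp only: prod.lessThan_Suc Suc.IH mult.assoc)
  qed simp
  also have "agree N \<dots> (qpoch [q] q)"
    using agree_qpoch[OF assms, of "3 * N" "[q]"] by (auto intro: agree_sym agree_mono)
  finally show "agree N (qpoch [q, q\<^sup>2, q ^ 3] (q ^ 3)) (qpoch [q] q)" .
qed

lemma qpoch_singleton_nth_0: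
  fixes q :: "'a::idom fps"
  assumes "q $ 0 = 0"
  shows "qpoch [q] q $ 0 = 1"
  using agree_qpoch[OF assms, of 1 "[q]"] assms by (simp add: agree_def)

section \<open>Coefficientwise finite sums of power series\<close>

text \<open>
  An infinite sum of power series makes sense if every coefficient of the sum involves only
  finitely many terms.
\<close>

definition coeffwise_finite :: "('i \<Rightarrow> 'a::comm_ring_1 fps) \<Rightarrow> 'i set \<Rightarrow> bool" where
  "coeffwise_finite f I \<longleftrightarrow> (\<forall>m. finite {i \<in> I. f i $ m \<noteq> 0})"

definition formal_sum :: "('i \<Rightarrow> 'a::comm_ring_1 fps) \<Rightarrow> 'i set \<Rightarrow> 'a fps" where
  "formal_sum f I = Abs_fps (\<lambda>m. \<Sum>i | i \<in> I \<and> f i $ m \<noteq> 0. f i $ m)"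

lemma formal_sum_nth:
  assumes "finite J" "J \<subseteq> I" "\<And>i. i \<in> I - J \<Longrightarrow> f i $ m = 0"
  shows "formal_sum f I $ m = (\<Sum>i\<in>J. f i $ m)"
  unfolding formal_sum_def fps_nth_Abs_fps
  using assms by (intro sum.mono_neutral_left) auto

lemma coeffwise_finite_subset:
  "coeffwise_finite f I \<Longrightarrow> J \<subseteq> I \<Longrightarrow> coeffwise_finite f J"
  unfolding coeffwise_finite_def by (auto intro: finite_subset[of _ "{i \<in> I. f i $ m \<noteq> 0}" for m])

lemma coeffwise_finite_le:
  assumes "coeffwise_finite f I"
  shows "finite {i \<in> I. \<exists>a\<le>m. f i $ a \<noteq> 0}"
proof -
  have "{i \<in> I. \<exists>a\<le>m. f i $ a \<noteq> 0} = (\<Union>a\<le>m. {i \<in> I. f i $ a \<noteq> 0})" by auto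
  then show ?thesis using assms by (simp add: coeffwise_finite_def)
qed

lemma formal_sum_cong: "(\<And>i. i \<in> I \<Longrightarrow> f i = g i) \<Longrightarrow> formal_sum f I = formal_sum g I"
  unfolding formal_sum_def by (intro arg_cong[of _ _ Abs_fps] ext sum.cong) auto

lemma formal_sum_uminus: "formal_sum (\<lambda>i. - f i) I = - formal_sum f I"
  by (simp add: fps_eq_iff formal_sum_def sum_negf)

lemma formal_sum_reindex:
  assumes "bij_betw h I J"
  shows "formal_sum (\<lambda>i. f (h i)) I = formal_sum f J"
proof (rule fps_ext)
  fix m
  have "bij_betw h {i \<in> I. f (h i) $ m \<noteq> 0} {j \<in> J. f j $ m \<noteq> 0}"
    using assms unfolding bij_betw_def by (auto intro: inj_on_subset)
  from sum.reindex_bij_betw[OF this, of "\<lambda>j. f j $ m"]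
  show "formal_sum (\<lambda>i. f (h i)) I $ m = formal_sum f J $ m"
    by (simp add: formal_sum_def)
qed

lemma formal_sum_Un_disjoint:
  assumes "coeffwise_finite f (I \<union> J)" "I \<inter> J = {}"
  shows "formal_sum f (I \<union> J) = formal_sum f I + formal_sum f J"
proof (rule fps_ext)
  fix m
  have fin: "finite {i \<in> I \<union> J. f i $ m \<noteq> 0}" using assms(1) by (simp add: coeffwise_finite_def)
  have "{i \<in> I \<union> J. f i $ m \<noteq> 0} = {i \<in> I. f i $ m \<noteq> 0} \<union> {i \<in> J. f i $ m \<noteq> 0}" by auto
  moreover have "finite {i \<in> I. f i $ m \<noteq> 0}" "finite {i \<in> J. f i $ m \<noteq> 0}"
    using fin by (auto elim: rev_finite_subset)
  ultimately show "formal_sum f (I \<union> J) $ m = (formal_sum f I + formal_sum f J) $ m"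
    unfolding formal_sum_def using assms(2)
    by (simp add: sum.union_disjoint[symmetric] disjoint_iff)
qed

lemma
  fixes f :: "'i \<Rightarrow> 'a::comm_ring_1 fps" and g :: "'j \<Rightarrow> 'a fps"
  assumes f: "coeffwise_finite f I" and g: "coeffwise_finite g J"
  shows formal_sum_mult:
      "formal_sum f I * formal_sum g J = formal_sum (\<lambda>(i, j). f i * g j) (I \<times> J)"
    and coeffwise_finite_mult: "coeffwise_finite (\<lambda>(i, j). f i * g j) (I \<times> J)"
proof -
  define I' where "I' m = {i \<in> I. \<exists>a\<le>m. f i $ a \<noteq> 0}" for m
  define J' where "J' m = {j \<in> J. \<exists>a\<le>m. g j $ a \<noteq> 0}" for m
  have fin: "finite (I' m)" "finite (J' m)" for m
    unfolding I'_def J'_def by (rule coeffwise_finite_le[OF f] coeffwise_finite_le[OF g])+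
  have zero: "(f i * g j) $ m = 0" if "(i, j) \<in> I \<times> J - I' m \<times> J' m" for i j m
    using that unfolding I'_def J'_def fps_mult_nth by (auto intro!: sum.neutral)
  show "coeffwise_finite (\<lambda>(i, j). f i * g j) (I \<times> J)"
    unfolding coeffwise_finite_def
  proof
    fix m
    show "finite {x \<in> I \<times> J. (case x of (i, j) \<Rightarrow> f i * g j) $ m \<noteq> 0}"
    proof (rule finite_subset)
      show "{x \<in> I \<times> J. (case x of (i, j) \<Rightarrow> f i * g j) $ m \<noteq> 0} \<subseteq> I' m \<times> J' m"
      proof
        fix x assume x: "x \<in> {x \<in> I \<times> J. (case x of (i, j) \<Rightarrow> f i * g j) $ m \<noteq> 0}"
        obtain i j where ij: "x = (i, j)" by (cases x)
        show "x \<in> I' m \<times> J' m" using x zero[of i j m] unfolding ij by auto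
      qed
    qed (use fin in simp)
  qed
  show "formal_sum f I * formal_sum g J = formal_sum (\<lambda>(i, j). f i * g j) (I \<times> J)"
  proof (rule fps_ext)
    fix m
    have F: "formal_sum f I $ a = (\<Sum>i\<in>I' m. f i $ a)" if "a \<le> m" for a
      using that by (intro formal_sum_nth fin) (auto simp: I'_def)
    have G: "formal_sum g J $ a = (\<Sum>i\<in>J' m. g i $ a)" if "a \<le> m" for a
      using that by (intro formal_sum_nth fin) (auto simp: J'_def)
    have "(formal_sum f I * formal_sum g J) $ m =
        (\<Sum>a=0..m. \<Sum>(i, j)\<in>I' m \<times> J' m. f i $ a * g j $ (m - a))"
      unfolding fps_mult_nth
      by (intro sum.cong refl) (simp add: F G sum_product sum.cartesian_product)
    also have "\<dots> = (\<Sum>(i, j)\<in>I' m \<times> J' m. (f i * g j) $ m)"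
      by (subst sum.swap) (simp add: fps_mult_nth case_prod_unfold)
    also have "\<dots> = (\<Sum>x\<in>I' m \<times> J' m. (case x of (i, j) \<Rightarrow> f i * g j) $ m)"
      by (intro sum.cong) auto
    also have "\<dots> = formal_sum (\<lambda>(i, j). f i * g j) (I \<times> J) $ m"
    proof (rule formal_sum_nth[symmetric])
      show "I' m \<times> J' m \<subseteq> I \<times> J" by (auto simp: I'_def J'_def)
      fix x assume x: "x \<in> I \<times> J - I' m \<times> J' m"
      obtain i j where ij: "x = (i, j)" by (cases x)
      show "(case x of (i, j) \<Rightarrow> f i * g j) $ m = 0" using x zero[of i j m] unfolding ij by auto
    qed (use fin in simp)
    finally show "(formal_sum f I * formal_sum g J) $ m =
      formal_sum (\<lambda>(i, j). f i * g j) (I \<times> J) $ m" .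
  qed
qed

section \<open>Gauss binomial coefficients\<close>

fun gauss_binomial :: "'a::comm_ring_1 \<Rightarrow> nat \<Rightarrow> nat \<Rightarrow> 'a" where
  "gauss_binomial q n 0 = 1"
| "gauss_binomial q 0 (Suc k) = 0"
| "gauss_binomial q (Suc n) (Suc k) =
     gauss_binomial q n k + q ^ Suc k * gauss_binomial q n (Suc k)"

lemma gauss_binomial_eq_0: "n < k \<Longrightarrow> gauss_binomial q n k = 0"
  by (induction q n k rule: gauss_binomial.induct) auto

lemma gauss_binomial_self [simp]: "gauss_binomial q n n = 1"
  by (induction n) (auto simp: gauss_binomial_eq_0)

text \<open>
  The second Pascal rule, with the power of \<open>q\<close> on the other summand. The two rules serve to
  enlarge the two factors of the finite triple product.
\<close>

lemma gauss_binomial_Suc_Suc':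
  "k \<le> n \<Longrightarrow> gauss_binomial q (Suc n) (Suc k) =
     gauss_binomial q n (Suc k) + q ^ (n - k) * gauss_binomial q n k"
proof (induction n arbitrary: k)
  case (Suc n)
  show ?case
  proof (cases k)
    case 0
    then show ?thesis using Suc.IH[of 0] by (simp add: algebra_simps)
  next
    case (Suc k')
    show ?thesis
    proof (cases "k = Suc n")
      case True
      then show ?thesis by (simp add: gauss_binomial_eq_0)
    next
      case False
      then have k: "k \<le> n" "k' \<le> n" using Suc Suc.prems by auto
      have e: "q ^ Suc k * q ^ (n - k) = q ^ (n - k') * q ^ k"
        unfolding power_add[symmetric] using k Suc by (intro arg_cong[of _ _ "power q"]) simp
      have "gauss_binomial q (Suc (Suc n)) (Suc k) =
          gauss_binomial q (Suc n) k + q ^ Suc k * gauss_binomial q (Suc n) (Suc k)" by simp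
      also have "\<dots> = (gauss_binomial q n k + q ^ Suc k * gauss_binomial q n (Suc k))
          + q ^ (n - k') * gauss_binomial q n k' + (q ^ Suc k * q ^ (n - k)) * gauss_binomial q n k"
        using Suc.IH[OF k(1)] Suc.IH[OF k(2)] \<open>k = Suc k'\<close> by (simp add: algebra_simps)
      also have "\<dots> = gauss_binomial q (Suc n) (Suc k) +
          q ^ (n - k') * (gauss_binomial q n k' + q ^ k * gauss_binomial q n k)"
        unfolding e by (simp add: algebra_simps)
      also have "\<dots> = gauss_binomial q (Suc n) (Suc k) + q ^ (Suc n - k) * gauss_binomial q (Suc n) k"
        using \<open>k = Suc k'\<close> by simp
      finally show ?thesis .
    qed
  qed
qed simp

text \<open>
  The quotient formula for the Gauss binomial coefficient, without denominators.
\<close>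

lemma gauss_binomial_mult_qfact:
  "gauss_binomial q (a + b) a * (\<Prod>i<a. 1 - q ^ Suc i) * (\<Prod>i<b. 1 - q ^ Suc i) =
     (\<Prod>i<a + b. 1 - q ^ Suc i)"
proof (induction "a + b" arbitrary: a b)
  case (Suc m)
  let ?P = "\<lambda>n. \<Prod>i<n. 1 - q ^ Suc i"
  show ?case
  proof (cases "a = 0 \<or> b = 0")
    case False
    then obtain c d where ab: "a = Suc c" "b = Suc d" by (metis not0_implies_Suc)
    have 2: "gauss_binomial q (a + d) a * ?P a * ?P d = ?P (a + d)"
      using Suc ab by (intro Suc.hyps) auto
    have eq: "c + b = a + d" "a + b = Suc (a + d)" using ab by auto
    have 1: "gauss_binomial q (c + b) c * ?P c * ?P b = ?P (a + d)"
      unfolding eq(1)[symmetric] using Suc ab by (intro Suc.hyps) auto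
    have "gauss_binomial q (a + b) a * ?P a * ?P b =
        (gauss_binomial q (c + b) c + q ^ a * gauss_binomial q (a + d) a) * ?P a * ?P b"
      unfolding eq(2) using ab by simp
    also have "\<dots> = gauss_binomial q (c + b) c * (?P c * (1 - q ^ a)) * ?P b
        + q ^ a * gauss_binomial q (a + d) a * ?P a * (?P d * (1 - q ^ b))"
      unfolding ab by (simp add: algebra_simps)
    also have "\<dots> = (gauss_binomial q (c + b) c * ?P c * ?P b) * (1 - q ^ a)
        + q ^ a * (1 - q ^ b) * (gauss_binomial q (a + d) a * ?P a * ?P d)"
      by (simp only: ac_simps)
    also have "\<dots> = ?P (a + d) * (1 - q ^ a) + q ^ a * (1 - q ^ b) * ?P (a + d)"
      by (simp only: 1 2)
    also have "\<dots> = ?P (a + d) * (1 - q ^ (a + b))"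
      by (simp add: algebra_simps power_add)
    also have "\<dots> = ?P (a + b)" unfolding eq(2) by simp
    finally show ?thesis .
  qed auto
qed simp

section \<open>The Jacobi triple product identity\<close>

text \<open>
  The triangular numbers, extended to negative indices. Both \<open>tri k\<close> and \<open>tri (- k)\<close> are
  natural numbers, so the terms below make sense for elements that are not invertible.
\<close>

definition tri :: "int \<Rightarrow> nat" where
  "tri k = nat (k * (k + 1) div 2)"

lemma two_tri: "2 * int (tri k) = k * (k + 1)"
proof -
  have "0 \<le> k * (k + 1)"
    by (cases "k \<ge> 0") (auto intro: mult_nonneg_nonneg mult_nonpos_nonpos)
  moreover have "even (k * (k + 1))" by simp
  ultimately show ?thesis unfolding tri_def by (simp add: pos_imp_zdiv_nonneg_iff)
qed

lemma tri_0 [simp]: "tri 0 = 0"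
  by (simp add: tri_def)

lemma abs_le_Suc_tri: "nat \<bar>k\<bar> \<le> Suc (tri k)"
proof -
  have "2 * \<bar>k\<bar> \<le> k * (k + 1) + 2"
  proof (cases "k \<ge> 0")
    case True
    have "0 \<le> k * (k - 1)"
      by (cases "k = 0") (use True in \<open>auto intro: mult_nonneg_nonneg\<close>)
    then show ?thesis using True by (simp add: algebra_simps)
  next
    case False
    have "0 \<le> (k + 1) * (k + 2)"
      by (cases "k \<ge> - 1") (use False in \<open>auto intro: mult_nonneg_nonneg mult_nonpos_nonpos\<close>)
    then show ?thesis using False by (simp add: algebra_simps)
  qed
  then show ?thesis using two_tri[of k] by linarith
qed

text \<open>
  The general term of Ramanujan's theta function \<open>f(u, w)\<close>. With \<open>Q = u w\<close> and \<open>z = u\<close> it is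
  \<open>Q\<^bsup>k (k - 1) / 2\<^esup> z\<^sup>k\<close>, written without negative powers.
\<close>

definition theta_term :: "'a::comm_ring_1 \<Rightarrow> 'a \<Rightarrow> int \<Rightarrow> 'a" where
  "theta_term u w k = u ^ tri k * w ^ tri (- k)"

lemma tri_Suc: "int (tri (k + 1)) = int (tri k) + k + 1" "int (tri (- k)) = int (tri k) - k"
  using two_tri[of k] two_tri[of "k + 1"] two_tri[of "- k"] by (simp_all add: algebra_simps)

lemma theta_term_step_u:
  assumes "k \<le> int M"
  shows "theta_term u w k * (u * (u * w) ^ M) = theta_term u w (k + 1) * (u * w) ^ nat (int M - k)"
proof -
  have 1: "tri k + 1 + M = tri (k + 1) + nat (int M - k)"
    using tri_Suc(1)[of k] assms by linarith
  have 2: "tri (- k) + M = tri (- (k + 1)) + nat (int M - k)"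
    using tri_Suc[of k] tri_Suc(2)[of "k + 1"] assms by linarith
  have "theta_term u w k * (u * (u * w) ^ M) = u ^ (tri k + 1 + M) * w ^ (tri (- k) + M)"
    by (simp add: theta_term_def power_add power_mult_distrib ac_simps)
  also have "\<dots> = theta_term u w (k + 1) * (u * w) ^ nat (int M - k)"
    unfolding 1 2 by (simp add: theta_term_def power_add power_mult_distrib ac_simps)
  finally show ?thesis .
qed

lemma theta_term_swap: "theta_term u w k = theta_term w u (- k)"
  by (simp add: theta_term_def mult.commute)

lemma theta_term_step_w:
  assumes "- int N \<le> k"
  shows "theta_term u w k * (w * (u * w) ^ N) = theta_term u w (k - 1) * (u * w) ^ nat (int N + k)"
  using theta_term_step_u[of "- k" N w u] assms
  by (simp add: theta_term_swap[of u w] mult.commute[of w u])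

text \<open>
  A new factor \<open>1 + u Q\<^sup>M\<close> or \<open>1 + w Q\<^sup>N\<close> shifts the index \<open>k\<close> of the theta terms by one, at the
  cost of a power of \<open>Q\<close>, which is just the power in one of the two Pascal rules. The summation
  index \<open>j = k + N\<close> is a natural number.
\<close>

lemma finite_jacobi_triple_product:
  fixes u w :: "'a::comm_ring_1"
  shows "(\<Prod>i<M. 1 + u * (u * w) ^ i) * (\<Prod>i<N. 1 + w * (u * w) ^ i) =
    (\<Sum>j\<le>M + N. gauss_binomial (u * w) (M + N) j * theta_term u w (int j - int N))"
proof (induction M)
  case 0
  show ?case
  proof (induction N)
    case 0
    show ?case by (simp add: theta_term_def)
  next
    case (Suc N)
    let ?g = "gauss_binomial (u * w)" and ?t = "theta_term u w"
    have "(\<Prod>i<Suc N. 1 + w * (u * w) ^ i) = (\<Sum>j\<le>N. ?g N j * ?t (int j - int N)) * (1 + w * (u * w) ^ N)"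
      using Suc by simp
    also have "\<dots> = (\<Sum>j\<le>N. ?g N j * ?t (int j - int N)) +
        (\<Sum>j\<le>N. ?g N j * ((u * w) ^ j * ?t (int j - int N - 1)))"
      unfolding sum_distrib_right distrib_left sum.distrib
      using theta_term_step_w[of N "int j - int N" u w for j]
      by (simp add: mult.assoc) (simp add: ac_simps)
    also have "(\<Sum>j\<le>N. ?g N j * ((u * w) ^ j * ?t (int j - int N - 1))) =
       (\<Sum>j\<le>Suc N. ?g N j * ((u * w) ^ j * ?t (int j - int N - 1)))"
      by (simp add: gauss_binomial_eq_0)
    also have "\<dots> = ?t (- int (Suc N)) + (\<Sum>j\<le>N. ?g N (Suc j) * ((u * w) ^ Suc j * ?t (int j - int N)))"
      by (subst sum.atMost_Suc_shift) (simp add: minus_diff_commute[of "int N" 1] add.commute)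
    also have "(\<Sum>j\<le>N. ?g N j * ?t (int j - int N)) + \<dots> =
        ?t (- int (Suc N)) + (\<Sum>j\<le>N. ?g (Suc N) (Suc j) * ?t (int (Suc j) - int (Suc N)))"
      by (simp add: sum.distrib[symmetric] algebra_simps)
    also have "\<dots> = (\<Sum>j\<le>Suc N. ?g (Suc N) j * ?t (int j - int (Suc N)))"
      by (subst sum.atMost_Suc_shift) (simp add: algebra_simps)
    finally show ?case by simp
  qed
next
  case (Suc M)
  let ?g = "gauss_binomial (u * w)" and ?t = "theta_term u w" and ?m = "M + N"
  have "(\<Prod>i<Suc M. 1 + u * (u * w) ^ i) * (\<Prod>i<N. 1 + w * (u * w) ^ i) =
      (\<Sum>j\<le>?m. ?g ?m j * ?t (int j - int N)) * (1 + u * (u * w) ^ M)"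
    unfolding Suc[symmetric] by (simp add: ac_simps)
  also have "\<dots> = (\<Sum>j\<le>?m. ?g ?m j * ?t (int j - int N)) +
      (\<Sum>j\<le>?m. ?g ?m j * (?t (int j - int N) * (u * (u * w) ^ M)))"
    by (simp add: sum_distrib_right distrib_left sum.distrib mult.assoc)
  also have "(\<Sum>j\<le>?m. ?g ?m j * (?t (int j - int N) * (u * (u * w) ^ M))) =
      (\<Sum>j\<le>?m. (u * w) ^ (?m - j) * ?g ?m j * ?t (int (Suc j) - int N))"
  proof (rule sum.cong[OF refl])
    fix j assume "j \<in> {..?m}"
    then have "int j - int N \<le> int M" "nat (int M - (int j - int N)) = ?m - j" by auto
    then show "?g ?m j * (?t (int j - int N) * (u * (u * w) ^ M)) =
        (u * w) ^ (?m - j) * ?g ?m j * ?t (int (Suc j) - int N)"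
      using theta_term_step_u[of "int j - int N" M u w] by (simp add: algebra_simps)
  qed
  also have "(\<Sum>j\<le>?m. ?g ?m j * ?t (int j - int N)) = (\<Sum>j\<le>Suc ?m. ?g ?m j * ?t (int j - int N))"
    by (simp add: gauss_binomial_eq_0)
  also have "\<dots> = ?t (- int N) + (\<Sum>j\<le>?m. ?g ?m (Suc j) * ?t (int (Suc j) - int N))"
    by (subst sum.atMost_Suc_shift) simp
  also have "\<dots> + (\<Sum>j\<le>?m. (u * w) ^ (?m - j) * ?g ?m j * ?t (int (Suc j) - int N)) =
      ?t (- int N) + (\<Sum>j\<le>?m. ?g (Suc ?m) (Suc j) * ?t (int (Suc j) - int N))"
    unfolding add.assoc sum.distrib[symmetric]
    by (intro arg_cong2[of _ _ _ _ "(+)"] refl sum.cong)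
      (simp only: gauss_binomial_Suc_Suc' atMost_iff distrib_right)
  also have "\<dots> = (\<Sum>j\<le>Suc ?m. ?g (Suc ?m) j * ?t (int j - int N))"
    by (subst sum.atMost_Suc_shift) simp
  finally show ?case by simp
qed

lemma theta_term_agree_0:
  fixes u w :: "'a::comm_ring_1 fps"
  assumes "(u * w) $ 0 = 0" and "L < nat \<bar>k\<bar>"
  shows "agree L (theta_term u w k) 0"
proof -
  define d where "d = min (tri k) (tri (- k))"
  have "L \<le> d" using abs_le_Suc_tri[of k] abs_le_Suc_tri[of "- k"] assms(2) by (simp add: d_def)
  have "theta_term u w k = (u * w) ^ d * (u ^ (tri k - d) * w ^ (tri (- k) - d))"
  proof -
    have "theta_term u w k = u ^ (d + (tri k - d)) * w ^ (d + (tri (- k) - d))"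
      by (simp add: theta_term_def d_def)
    also have "\<dots> = (u * w) ^ d * (u ^ (tri k - d) * w ^ (tri (- k) - d))"
      unfolding power_add power_mult_distrib by (simp only: ac_simps)
    finally show ?thesis .
  qed
  then show ?thesis using agree_power_mult_zero[OF assms(1) \<open>L \<le> d\<close>] by simp
qed

lemma theta_term_coeffwise_finite:
  fixes u w :: "'a::comm_ring_1 fps"
  assumes "(u * w) $ 0 = 0"
  shows "coeffwise_finite (theta_term u w) UNIV"
  unfolding coeffwise_finite_def
proof
  fix m
  show "finite {k \<in> UNIV. theta_term u w k $ m \<noteq> 0}"
  proof (rule finite_subset)
    show "{k \<in> UNIV. theta_term u w k $ m \<noteq> 0} \<subseteq> {- int (Suc m)..int (Suc m)}"
    proof
      fix k assume "k \<in> {k \<in> UNIV. theta_term u w k $ m \<noteq> 0}"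
      then have "\<not> agree (Suc m) (theta_term u w k) 0" by (auto simp: agree_def)
      then have "\<not> Suc m < nat \<bar>k\<bar>" using theta_term_agree_0[OF assms] by blast
      then show "k \<in> {- int (Suc m)..int (Suc m)}" by auto
    qed
  qed simp
qed

text \<open>
  Central Gauss binomial coefficients tend to \<open>1 / (Q; Q)\<^sub>\<infinity>\<close>: in the quotient formula all three
  products may be replaced by \<open>(Q; Q)\<^sub>\<infinity>\<close>.
\<close>

lemma agree_gauss_binomial:
  fixes Q :: "'a::field fps"
  assumes "Q $ 0 = 0" "L \<le> a" "L \<le> b"
  shows "agree L (gauss_binomial Q (a + b) a * qpoch [Q] Q) 1"
proof -
  let ?P = "\<lambda>n. \<Prod>i<n. 1 - Q ^ Suc i" and ?E = "qpoch [Q] Q"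
  have E: "agree L ?E (?P n)" if "L \<le> n" for n
    using agree_qpoch[OF assms(1), of n "[Q]"] that by (auto intro: agree_mono)
  have "agree L (gauss_binomial Q (a + b) a * ?E * ?E) (gauss_binomial Q (a + b) a * ?P a * ?P b)"
    by (intro agree_mult agree_refl E assms)
  also have "\<dots> = ?P (a + b)" by (rule gauss_binomial_mult_qfact)
  also have "agree L \<dots> (1 * ?E)" using E[of "a + b"] assms by (auto intro: agree_sym)
  finally show ?thesis
    by (rule agree_cancel_unit) (simp add: qpoch_singleton_nth_0[OF assms(1)])
qed

text \<open>
  Up to the order \<open>L\<close> the finite version with \<open>M = N = 2 L + 1\<close> suffices: the theta terms with
  \<open>\<bar>k\<bar> > L\<close> vanish to this order, and for \<open>\<bar>k\<bar> \<le> L\<close> the Gauss binomial coefficient is so central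
  that it agrees with its limit.
\<close>

theorem jacobi_triple_product:
  fixes u w :: "'a::field fps"
  assumes Q: "(u * w) $ 0 = 0"
  shows "qpoch [- u, - w, u * w] (u * w) = formal_sum (theta_term u w) UNIV"
proof (rule agree_all_imp_eq)
  fix L :: nat
  let ?Q = "u * w" and ?t = "theta_term u w"
  define N where "N = 2 * L + 1"
  let ?U = "\<Prod>i<N. 1 + u * ?Q ^ i" and ?W = "\<Prod>i<N. 1 + w * ?Q ^ i"
  let ?E = "qpoch [?Q] ?Q"
  have "qpoch [- u, - w, ?Q] ?Q = qpoch [- u] ?Q * qpoch [- w] ?Q * ?E"
    by (simp add: qpoch_Cons[OF Q, of _ "_ # _"] mult.assoc)
  also have "agree L \<dots> (?U * ?W * ?E)"
    using agree_qpoch[OF Q, of N "[- u]"] agree_qpoch[OF Q, of N "[- w]"]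
    by (intro agree_mult agree_refl agree_mono[of N _ _ L]) (simp_all add: N_def)
  also have "?U * ?W * ?E =
      (\<Sum>j\<le>N + N. gauss_binomial ?Q (N + N) j * ?E * ?t (int j - int N))"
    unfolding finite_jacobi_triple_product sum_distrib_right by (simp only: ac_simps)
  also have "agree L \<dots> (\<Sum>j\<le>N + N. ?t (int j - int N))"
  proof (rule agree_sum)
    fix j assume j: "j \<in> {..N + N}"
    show "agree L (gauss_binomial ?Q (N + N) j * ?E * ?t (int j - int N)) (?t (int j - int N))"
    proof (cases "L < nat \<bar>int j - int N\<bar>")
      case True
      then have t: "agree L (?t (int j - int N)) 0" by (rule theta_term_agree_0[OF Q])
      have "agree L (gauss_binomial ?Q (N + N) j * ?E * ?t (int j - int N))
          (gauss_binomial ?Q (N + N) j * ?E * 0)"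
        by (intro agree_mult agree_refl t)
      then show ?thesis using t agree_sym agree_trans by fastforce
    next
      case False
      then have "L \<le> j" "L \<le> N + N - j" and eq: "j + (N + N - j) = N + N"
        using j unfolding N_def by auto
      then have "agree L (gauss_binomial ?Q (j + (N + N - j)) j * ?E) 1"
        by (intro agree_gauss_binomial Q)
      then have "agree L (gauss_binomial ?Q (N + N) j * ?E * ?t (int j - int N)) (1 * ?t (int j - int N))"
        unfolding eq by (rule agree_mult) simp
      then show ?thesis by simp
    qed
  qed
  also have "(\<Sum>j\<le>N + N. ?t (int j - int N)) = (\<Sum>k\<in>{- int N..int N}. ?t k)"
    by (rule sum.reindex_bij_witness[of _ "\<lambda>k. nat (k + int N)" "\<lambda>j. int j - int N"]) auto
  also have "agree L \<dots> (formal_sum ?t UNIV)"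
    unfolding agree_def
  proof (intro allI impI)
    fix i assume "i < L"
    have "formal_sum ?t UNIV $ i = (\<Sum>k\<in>{- int N..int N}. ?t k $ i)"
    proof (rule formal_sum_nth)
      fix k assume "k \<in> UNIV - {- int N..int N}"
      then have "L < nat \<bar>k\<bar>" by (auto simp: N_def)
      from theta_term_agree_0[OF Q this] \<open>i < L\<close> show "?t k $ i = 0" by (simp add: agree_def)
    qed auto
    then show "(\<Sum>k\<in>{- int N..int N}. ?t k) $ i = formal_sum ?t UNIV $ i"
      by (simp add: fps_sum_nth)
  qed
  finally show "agree L (qpoch [- u, - w, ?Q] ?Q) (formal_sum ?t UNIV)" .
qed

text \<open>
  The sign \<open>(-1)\<^sup>k\<close> for an integer \<open>k\<close>, in rings without inverses.
\<close>

definition alt :: "int \<Rightarrow> 'a::comm_ring_1" where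
  "alt k = (if even k then 1 else - 1)"

lemma alt_add: "alt (j + k) = alt j * alt k"
  by (simp add: alt_def)

lemma minus_power_alt: "(- x) ^ n = alt (int n) * (x :: 'a::comm_ring_1) ^ n"
  by (simp add: alt_def)

lemma tri_add_tri_uminus: "int (tri k) + int (tri (- k)) = k\<^sup>2"
  using two_tri[of k] two_tri[of "- k"] by (simp add: algebra_simps power2_eq_square)

lemma theta_term_uminus:
  "theta_term (- u) (- w) k = alt k * theta_term u w (k :: int)"
proof -
  have "alt (int (tri k)) * alt (int (tri (- k))) = (alt (k\<^sup>2) :: 'a)"
    unfolding tri_add_tri_uminus[symmetric] alt_add ..
  also have "\<dots> = alt k" by (simp add: alt_def)
  finally have "alt k * theta_term u w k =
      (alt (int (tri k)) * u ^ tri k) * (alt (int (tri (- k))) * w ^ tri (- k))"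
    unfolding theta_term_def by (metis (no_types, lifting) mult.assoc mult.left_commute)
  then show ?thesis by (simp add: theta_term_def minus_power_alt)
qed

text \<open>
  The generalized pentagonal numbers.
\<close>

definition pent :: "int \<Rightarrow> nat" where
  "pent k = nat (k * (3 * k + 1) div 2)"

lemma two_pent: "2 * int (pent k) = k * (3 * k + 1)"
proof -
  have "0 \<le> k * (3 * k + 1)"
    by (cases "k \<ge> 0") (auto intro: mult_nonneg_nonneg mult_nonpos_nonpos)
  moreover have "even (k * (3 * k + 1))" by simp
  ultimately show ?thesis unfolding pent_def by (simp add: pos_imp_zdiv_nonneg_iff)
qed

lemma pent_theta_term: "alt i * q ^ pent i = theta_term (- (q\<^sup>2)) (- q) i"
proof -
  have "int (pent i) = int (2 * tri i + tri (- i))"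
    using two_tri[of i] two_tri[of "- i"] two_pent[of i] by (simp add: algebra_simps)
  then have "pent i = 2 * tri i + tri (- i)" by (simp only: of_nat_eq_iff)
  then show ?thesis
    unfolding theta_term_uminus by (simp add: theta_term_def power_add power_mult)
qed

text \<open>
  Euler's pentagonal number theorem is the triple product in base \<open>q\<^sup>3\<close>.
\<close>

theorem pentagonal_number:
  fixes q :: "'a::field fps"
  assumes "q $ 0 = 0"
  shows "qpoch [q] q = formal_sum (\<lambda>i. alt i * q ^ pent i) UNIV"
proof -
  have "(- (q\<^sup>2)) * (- q) = q ^ 3" by (simp add: power2_eq_square power3_eq_cube)
  then have "qpoch [q\<^sup>2, q, q ^ 3] (q ^ 3) = formal_sum (theta_term (- (q\<^sup>2)) (- q)) UNIV"
    using jacobi_triple_product[of "- (q\<^sup>2)" "- q"] assms by simp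
  also have "qpoch [q\<^sup>2, q, q ^ 3] (q ^ 3) = qpoch [q, q\<^sup>2, q ^ 3] (q ^ 3)"
    by (simp add: qpoch_def mult.left_commute)
  also have "\<dots> = qpoch [q] q" by (rule qpoch_trisect[OF assms])
  finally show ?thesis by (simp add: pent_theta_term)
qed

section \<open>The quintuple product identity\<close>

lemma coeffwise_finite_reindex:
  assumes "coeffwise_finite f J" "inj_on h I" "h ` I \<subseteq> J"
  shows "coeffwise_finite (\<lambda>i. f (h i)) I"
  unfolding coeffwise_finite_def
proof
  fix m
  have "finite {j \<in> J. f j $ m \<noteq> 0}" using assms(1) by (simp add: coeffwise_finite_def)
  then have "finite (h ` {i \<in> I. f (h i) $ m \<noteq> 0})"
    by (rule rev_finite_subset) (use assms(3) in auto)
  then show "finite {i \<in> I. f (h i) $ m \<noteq> 0}"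
    by (rule finite_imageD) (rule inj_on_subset[OF assms(2)], auto)
qed

lemma quintuple_exponents_nonneg:
  fixes j :: int
  shows "0 \<le> 3 * j\<^sup>2 - 2 * j" "0 \<le> 3 * j\<^sup>2 + 4 * j + 1"
proof -
  have "3 * j\<^sup>2 - 2 * j = j\<^sup>2 + 4 * int (tri (- j))" "3 * j\<^sup>2 + 4 * j + 1 = (j + 1)\<^sup>2 + 4 * int (tri j)"
    using two_tri[of "- j"] two_tri[of j] by (simp_all add: algebra_simps power2_eq_square)
  then show "0 \<le> 3 * j\<^sup>2 - 2 * j" "0 \<le> 3 * j\<^sup>2 + 4 * j + 1"
    using zero_le_power2[of j] zero_le_power2[of "j + 1"] by linarith+
qed

text \<open>
  With \<open>z = u\<close> and \<open>Q = u\<^sup>2 v\<close> the left-hand side is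
  \<open>(- z, - Q / z, Q; Q)\<^sub>\<infinity> (Q z\<^sup>2, Q / z\<^sup>2; Q\<^sup>2)\<^sub>\<infinity>\<close>, and the two sums on the right-hand side have the
  terms \<open>(-1)\<^sup>j Q\<^bsup>j (3 j + 1) / 2\<^esup> z\<^bsup>- 3 j\<^esup>\<close> and \<open>(-1)\<^sup>j Q\<^bsup>j (3 j + 1) / 2\<^esup> z\<^bsup>3 j + 1\<^esup>\<close>; the
  parameters \<open>u\<close> and \<open>v = Q / z\<^sup>2\<close> avoid negative powers.

  Multiplication by \<open>(Q\<^sup>2; Q\<^sup>2)\<^sub>\<infinity>\<close> turns the left-hand side into a product of two triple
  products, hence into a double sum with indices \<open>m\<close> and \<open>l\<close>. The power of \<open>z\<close> in its terms is
  \<open>m + 2 l\<close>, which is congruent to \<open>m - l\<close> modulo 3. In each residue class the exponent of \<open>Q\<close>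
  separates into a part that depends on the power of \<open>z\<close> and a part that depends on a second
  index \<open>i\<close>. For the residues 0 and 1 the sum over \<open>i\<close> is the pentagonal series for
  \<open>(Q\<^sup>2; Q\<^sup>2)\<^sub>\<infinity>\<close>, which cancels in the end. For the residue 2 the reflection of \<open>i\<close> at \<open>1 / 2\<close>
  changes only the sign of the terms, so this class contributes nothing.
\<close>

theorem quintuple_product:
  fixes u v :: "'a::field_char_0 fps"
  assumes "(u\<^sup>2 * v) $ 0 = 0"
  shows "qpoch [- u, - (u * v), u\<^sup>2 * v] (u\<^sup>2 * v) * qpoch [u ^ 4 * v, v] ((u\<^sup>2 * v)\<^sup>2) =
    formal_sum (\<lambda>j. alt j * (u ^ nat (3 * j\<^sup>2 - 2 * j) * v ^ pent j)) UNIV +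
    formal_sum (\<lambda>j. alt j * (u ^ nat (3 * j\<^sup>2 + 4 * j + 1) * v ^ pent j)) UNIV"
    (is "?L = formal_sum ?S1 UNIV + formal_sum ?S2 UNIV")
proof -
  define Q where "Q = u\<^sup>2 * v"
  have Q0: "Q $ 0 = 0" "(Q\<^sup>2) $ 0 = 0" using assms by (simp_all add: Q_def power2_eq_square)
  have uw: "u * (u * v) = Q" "(- (u ^ 4 * v)) * (- v) = Q\<^sup>2" "(u ^ 4 * v) * v = Q\<^sup>2"
    by (simp_all add: Q_def power2_eq_square power4_eq_xxxx ac_simps)
  define f where "f = theta_term u (u * v)"
  define g where "g = theta_term (- (u ^ 4 * v)) (- v)"
  define h where "h = (\<lambda>(m, l). f m * g l)"
  define P where "P = (\<lambda>i. alt i * (Q\<^sup>2) ^ pent i)"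
  have fin: "coeffwise_finite f UNIV" "coeffwise_finite g UNIV" "coeffwise_finite P UNIV"
    unfolding f_def g_def P_def pent_theta_term
    by (intro theta_term_coeffwise_finite, simp add: uw Q0 assms)+
  have fin_h: "coeffwise_finite h UNIV"
    using coeffwise_finite_mult[OF fin(1,2)] by (simp add: h_def)
  have h: "h (m, l) = alt l * (u ^ (tri m + tri (- m) + 4 * tri l) * v ^ (tri (- m) + tri l + tri (- l)))"
    for m l
    unfolding h_def f_def g_def prod.case theta_term_uminus
    by (simp add: theta_term_def power_add power_mult_distrib ac_simps flip: power_mult)
  define a where "a j = nat (3 * j\<^sup>2 - 2 * j)" for j :: int
  define b where "b j = nat (3 * j\<^sup>2 + 4 * j + 1)" for j :: int
  have e1: "int (a j) = 3 * j\<^sup>2 - 2 * j" and e2: "int (b j) = 3 * j\<^sup>2 + 4 * j + 1" for j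
    using quintuple_exponents_nonneg[of j] by (simp_all add: a_def b_def)
  have h0: "h (- j - 2 * i, i - j) = ?S1 j * P i" for i j
  proof -
    let ?m = "- j - 2 * i" and ?l = "i - j"
    have u: "tri ?m + tri (- ?m) + 4 * tri ?l = a j + 4 * pent i"
      using two_tri[of ?m] two_tri[of "- ?m"] two_tri[of ?l] two_pent[of i] e1[of j]
      by (simp add: algebra_simps power2_eq_square)
    have v: "tri (- ?m) + tri ?l + tri (- ?l) = pent j + 2 * pent i"
      using two_tri[of "- ?m"] two_tri[of ?l] two_tri[of "- ?l"] two_pent[of i] two_pent[of j]
      by (simp add: algebra_simps power2_eq_square)
    have s: "alt ?l = alt j * alt i" by (simp add: alt_def)
    show ?thesis unfolding h u v s a_def[symmetric]
      by (simp add: P_def Q_def power_add power_mult_distrib ac_simps flip: power_mult)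
  qed
  have h1: "h (j + 1 + 2 * i, j - i) = ?S2 j * P i" for i j
  proof -
    let ?m = "j + 1 + 2 * i" and ?l = "j - i"
    have u: "tri ?m + tri (- ?m) + 4 * tri ?l = b j + 4 * pent i"
      using two_tri[of ?m] two_tri[of "- ?m"] two_tri[of ?l] two_pent[of i] e2[of j]
      by (simp add: algebra_simps power2_eq_square)
    have v: "tri (- ?m) + tri ?l + tri (- ?l) = pent j + 2 * pent i"
      using two_tri[of "- ?m"] two_tri[of ?l] two_tri[of "- ?l"] two_pent[of i] two_pent[of j]
      by (simp add: algebra_simps power2_eq_square)
    have s: "alt ?l = alt j * alt i" by (simp add: alt_def)
    show ?thesis unfolding h u v s b_def[symmetric]
      by (simp add: P_def Q_def power_add power_mult_distrib ac_simps flip: power_mult)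
  qed
  have h2: "h (j + 2 - 2 * (1 - i), j + (1 - i)) = - h (j + 2 - 2 * i, j + i)" for i j
  proof -
    let ?m = "j + 2 - 2 * i" and ?l = "j + i" and ?m' = "j + 2 - 2 * (1 - i)" and ?l' = "j + (1 - i)"
    have u: "tri ?m' + tri (- ?m') + 4 * tri ?l' = tri ?m + tri (- ?m) + 4 * tri ?l"
      using two_tri[of ?m] two_tri[of "- ?m"] two_tri[of ?l] two_tri[of ?m'] two_tri[of "- ?m'"] two_tri[of ?l']
      by (simp add: algebra_simps power2_eq_square)
    have v: "tri (- ?m') + tri ?l' + tri (- ?l') = tri (- ?m) + tri ?l + tri (- ?l)"
      using two_tri[of "- ?m"] two_tri[of ?l] two_tri[of "- ?l"] two_tri[of "- ?m'"] two_tri[of ?l'] two_tri[of "- ?l'"]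
      by (simp add: algebra_simps power2_eq_square)
    have s: "alt ?l' = (- alt ?l :: 'a fps)" by (simp add: alt_def)
    show ?thesis unfolding h u v s by simp
  qed
  define C where "C c = {(m, l). (m - l) mod 3 = (c :: int)}" for c
  have b0: "bij_betw (\<lambda>(j, i). (- j - 2 * i, i - j)) (UNIV \<times> UNIV) (C 0)"
    by (rule bij_betw_byWitness[where f' = "\<lambda>(m, l). ((l - m) div 3 - l, (l - m) div 3)"])
      (auto simp: C_def, presburger+)
  have b1: "bij_betw (\<lambda>(j, i). (j + 1 + 2 * i, j - i)) (UNIV \<times> UNIV) (C 1)"
    by (rule bij_betw_byWitness[where f' = "\<lambda>(m, l). ((m - l) div 3 + l, (m - l) div 3)"])
      (auto simp: C_def, presburger+)
  have b2: "bij_betw (\<lambda>(j, i). (j + 2 - 2 * i, j + i)) (UNIV \<times> UNIV) (C 2)"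
    by (rule bij_betw_byWitness[where f' = "\<lambda>(m, l). (l + (m - l) div 3, - ((m - l) div 3))"])
      (auto simp: C_def, presburger+)
  have finS: "coeffwise_finite ?S1 UNIV" "coeffwise_finite ?S2 UNIV"
  proof -
    have "coeffwise_finite (\<lambda>j. h (- j, - j)) UNIV" "coeffwise_finite (\<lambda>j. h (j + 1, j)) UNIV"
      by (rule coeffwise_finite_reindex[OF fin_h]; auto simp: inj_on_def)+
    then show "coeffwise_finite ?S1 UNIV" "coeffwise_finite ?S2 UNIV"
      using h0[of _ 0] h1[of _ 0] by (simp_all add: P_def pent_def alt_def)
  qed
  have E: "formal_sum P UNIV = qpoch [Q\<^sup>2] (Q\<^sup>2)"
    unfolding P_def by (rule pentagonal_number[OF Q0(2), symmetric])
  have s0: "formal_sum h (C 0) = formal_sum ?S1 UNIV * formal_sum P UNIV"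
    unfolding formal_sum_mult[OF finS(1) fin(3)] formal_sum_reindex[OF b0, symmetric]
    by (rule formal_sum_cong) (auto simp: h0)
  have s1: "formal_sum h (C 1) = formal_sum ?S2 UNIV * formal_sum P UNIV"
    unfolding formal_sum_mult[OF finS(2) fin(3)] formal_sum_reindex[OF b1, symmetric]
    by (rule formal_sum_cong) (auto simp: h1)
  have s2: "formal_sum h (C 2) = 0"
  proof -
    define T where "T = (\<lambda>(j, i). h (j + 2 - 2 * i, j + i))"
    have "formal_sum h (C 2) = formal_sum T (UNIV \<times> UNIV)"
      unfolding T_def formal_sum_reindex[OF b2, symmetric] by (rule formal_sum_cong) auto
    moreover have "formal_sum T (UNIV \<times> UNIV) = - formal_sum T (UNIV \<times> UNIV)"
    proof -
      have b: "bij_betw (\<lambda>(j, i). (j, 1 - i)) (UNIV \<times> UNIV) (UNIV \<times> (UNIV :: int set))"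
        by (rule bij_betw_byWitness[where f' = "\<lambda>(j, i). (j, 1 - i)"]) auto
      have "formal_sum T (UNIV \<times> UNIV) = formal_sum (\<lambda>x. T ((\<lambda>(j, i). (j, 1 - i)) x)) (UNIV \<times> UNIV)"
        by (rule formal_sum_reindex[OF b, symmetric])
      also have "\<dots> = formal_sum (\<lambda>x. - T x) (UNIV \<times> UNIV)"
      proof (rule formal_sum_cong)
        fix x :: "int \<times> int"
        obtain j i where x: "x = (j, i)" by (cases x)
        show "T ((\<lambda>(j, i). (j, 1 - i)) x) = - T x"
          unfolding x T_def prod.case by (rule h2)
      qed
      finally show ?thesis unfolding formal_sum_uminus .
    qed
    then have "2 * formal_sum T (UNIV \<times> UNIV) = 0"
      by (simp only: eq_neg_iff_add_eq_0 mult_2)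
    then have "formal_sum T (UNIV \<times> UNIV) = 0" by simp
    ultimately show ?thesis by simp
  qed
  have U: "UNIV = C 0 \<union> (C 1 \<union> C 2)"
  proof -
    have "(m - l) mod 3 = 0 \<or> (m - l) mod 3 = 1 \<or> (m - l) mod 3 = 2" for m l :: int by presburger
    then show ?thesis by (auto simp: C_def)
  qed
  have "formal_sum h UNIV = formal_sum h (C 0) + formal_sum h (C 1 \<union> C 2)"
    unfolding U by (rule formal_sum_Un_disjoint) (use fin_h in \<open>simp add: U[symmetric]\<close>, auto simp: C_def)
  also have "formal_sum h (C 1 \<union> C 2) = formal_sum h (C 1) + formal_sum h (C 2)"
    by (rule formal_sum_Un_disjoint) (rule coeffwise_finite_subset[OF fin_h], auto simp: C_def)
  finally have sum: "formal_sum h UNIV = (formal_sum ?S1 UNIV + formal_sum ?S2 UNIV) * qpoch [Q\<^sup>2] (Q\<^sup>2)"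
    by (simp add: s0 s1 s2 E distrib_right)
  have "qpoch [- u, - (u * v), Q] Q = formal_sum f UNIV"
    using jacobi_triple_product[of u "u * v"] Q0 by (simp add: uw f_def)
  moreover have "qpoch [u ^ 4 * v, v, Q\<^sup>2] (Q\<^sup>2) = formal_sum g UNIV"
    using jacobi_triple_product[of "- (u ^ 4 * v)" "- v"] Q0 by (simp add: uw g_def)
  moreover have "qpoch [u ^ 4 * v, v, Q\<^sup>2] (Q\<^sup>2) = qpoch [u ^ 4 * v, v] (Q\<^sup>2) * qpoch [Q\<^sup>2] (Q\<^sup>2)"
    by (simp add: qpoch_Cons[OF Q0(2), of _ "_ # _"] mult.assoc)
  ultimately have "?L * qpoch [Q\<^sup>2] (Q\<^sup>2) = formal_sum f UNIV * formal_sum g UNIV"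
    unfolding Q_def by (simp add: mult.assoc)
  also have "\<dots> = formal_sum h UNIV"
    using formal_sum_mult[OF fin(1,2)] by (simp add: h_def)
  also note sum
  finally have "?L * qpoch [Q\<^sup>2] (Q\<^sup>2) =
    (formal_sum ?S1 UNIV + formal_sum ?S2 UNIV) * qpoch [Q\<^sup>2] (Q\<^sup>2)" .
  moreover have "qpoch [Q\<^sup>2] (Q\<^sup>2) \<noteq> 0"
    using qpoch_singleton_nth_0[OF Q0(2)] by auto
  ultimately show ?thesis by simp
qed

section \<open>Counting integers by residues modulo two coprime moduli\<close>

lemma residue_unique:
  fixes P P' r r' m :: int
  assumes "coprime P P'" "0 < r" "r < P" "0 < r'" "r' < P" "P' * r - P' * r' = P * m"
  shows "r = r'"
proof -
  have "P dvd P' * (r - r')" using assms(6) by (simp add: right_diff_distrib)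
  then have "P dvd r - r'" using assms(1) by (simp add: coprime_dvd_mult_right_iff)
  then have "\<not> \<bar>r - r'\<bar> < \<bar>P\<bar>" if "r - r' \<noteq> 0"
    using that dvd_imp_le_int[of "r - r'" P] by linarith
  then show ?thesis using assms(2-5) by linarith
qed

text \<open>
  The residue of \<open>x\<close> modulo \<open>P\<close> determines \<open>r\<close> and that modulo \<open>P'\<close> determines \<open>s\<close>; both are in the
  open intervals because \<open>x\<close> is divisible by neither modulus. Then \<open>x = P' r - P s + P P' t\<close>.
  If \<open>t\<close> is even, this is of the first form. If \<open>t\<close> is odd, replacing \<open>r\<close> by \<open>P - r\<close> makes it of
  the second form. The parity of \<open>t\<close> also shows that the two forms exclude each other.
\<close>

lemma sum_over_coprime_residues:
  fixes P P' :: int and X :: "int set" and G :: "int \<Rightarrow> 'a::comm_monoid_add"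
  assumes cop: "coprime P P'" and pos: "P > 0" "P' > 0" and X: "finite X"
  shows "(\<Sum>x | x \<in> X \<and> \<not> P dvd x \<and> \<not> P' dvd x. G x) =
    (\<Sum>(r, s)\<in>{0<..<P} \<times> {0<..<P'}.
       (\<Sum>j | 2 * P * P' * j + P' * r - P * s \<in> X. G (2 * P * P' * j + P' * r - P * s)) +
       (\<Sum>j | - (2 * P * P' * j + P' * r + P * s) \<in> X. G (- (2 * P * P' * j + P' * r + P * s))))"
proof -
  let ?B = "{0<..<P} \<times> {0<..<P'}"
  let ?D = "{x. x \<in> X \<and> \<not> P dvd x \<and> \<not> P' dvd x}"
  define f where "f = (\<lambda>((r, s), j). 2 * P * P' * j + P' * r - P * s)"
  define g where "g = (\<lambda>((r, s), j). - (2 * P * P' * j + P' * r + P * s))"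
  have cop': "coprime P' P" using cop by (simp add: coprime_commute)
  have PP: "2 * P * P' \<noteq> 0" using pos by simp
  have inj_f: "inj_on f (?B \<times> UNIV)"
  proof (rule inj_onI)
    fix z z' assume zB: "z \<in> ?B \<times> UNIV" "z' \<in> ?B \<times> UNIV" and eq: "f z = f z'"
    obtain r s j r' s' j' where z: "z = ((r, s), j)" "z' = ((r', s'), j')" by (metis prod.exhaust)
    have b: "0 < r" "r < P" "0 < s" "s < P'" "0 < r'" "r' < P" "0 < s'" "s' < P'"
      using zB by (auto simp: z)
    have eq: "2 * P * P' * j + P' * r - P * s = 2 * P * P' * j' + P' * r' - P * s'"
      using eq unfolding z f_def prod.case by linarith
    have "P' * r - P' * r' = P * (s - s' + 2 * P' * (j' - j))" using eq by (simp add: algebra_simps)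
    then have r: "r = r'" using residue_unique[OF cop] b by blast
    have "P * s - P * s' = P' * (r - r' + 2 * P * (j - j'))" using eq by (simp add: algebra_simps)
    then have s: "s = s'" using residue_unique[OF cop'] b by blast
    have "2 * P * P' * j = 2 * P * P' * j'" using eq r s by simp
    then show "z = z'" using PP r s z by (metis mult_left_cancel)
  qed
  have inj_g: "inj_on g (?B \<times> UNIV)"
  proof (rule inj_onI)
    fix z z' assume zB: "z \<in> ?B \<times> UNIV" "z' \<in> ?B \<times> UNIV" and eq: "g z = g z'"
    obtain r s j r' s' j' where z: "z = ((r, s), j)" "z' = ((r', s'), j')" by (metis prod.exhaust)
    have b: "0 < r" "r < P" "0 < s" "s < P'" "0 < r'" "r' < P" "0 < s'" "s' < P'"
      using zB by (auto simp: z)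
    have eq: "2 * P * P' * j + P' * r + P * s = 2 * P * P' * j' + P' * r' + P * s'"
      using eq unfolding z g_def prod.case by linarith
    have "P' * r - P' * r' = P * (s' - s + 2 * P' * (j' - j))" using eq by (simp add: algebra_simps)
    then have r: "r = r'" using residue_unique[OF cop] b by blast
    have "P * s - P * s' = P' * (r' - r + 2 * P * (j' - j))" using eq by (simp add: algebra_simps)
    then have s: "s = s'" using residue_unique[OF cop'] b by blast
    have "2 * P * P' * j = 2 * P * P' * j'" using eq r s by simp
    then show "z = z'" using PP r s z by (metis mult_left_cancel)
  qed
  have disj: "f z \<noteq> g z'" if "z \<in> ?B \<times> UNIV" "z' \<in> ?B \<times> UNIV" for z z'
  proof
    obtain r s j r' s' j' where z: "z = ((r, s), j)" "z' = ((r', s'), j')" by (metis prod.exhaust)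
    assume "f z = g z'"
    then have eq: "2 * P * P' * j + P' * r - P * s = - (2 * P * P' * j' + P' * r' + P * s')"
      by (simp add: f_def g_def z)
    have b: "0 < r" "r < P" "0 < s" "s < P'" "0 < P - r'" "P - r' < P" "0 < s'" "s' < P'"
      using that by (auto simp: z)
    have "P' * r - P' * (P - r') = P * (s - s' - P' - 2 * P' * (j + j'))" using eq by (simp add: algebra_simps)
    then have r: "r = P - r'" using residue_unique[OF cop] b by blast
    have "P * s - P * s' = P' * (r + r' + 2 * P * (j + j'))" using eq by (simp add: algebra_simps)
    then have s: "s = s'" using residue_unique[OF cop'] b by blast
    have "(P * P') * (2 * (j + j') + 1) = 0" using eq r s by (simp add: algebra_simps)
    then have "2 * (j + j') + 1 = 0" using pos by simp
    then show False by presburger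
  qed
  have img: "x \<in> f ` (?B \<times> UNIV) \<union> g ` (?B \<times> UNIV)" if "\<not> P dvd x" "\<not> P' dvd x" for x
  proof -
    obtain u v where uv: "u * P' + v * P = 1" using bezout_int[of P' P] cop' by auto
    define r where "r = (x * u) mod P"
    define s where "s = (- x * v) mod P'"
    define t where "t = (x * u) div P - (- x * v) div P'"
    have "x = x * (u * P' + v * P)" using uv by simp
    also have "\<dots> = P' * (x * u) - P * (- x * v)" by (simp add: algebra_simps)
    also have "x * u = P * ((x * u) div P) + r" by (simp add: r_def)
    also have "- x * v = P' * ((- x * v) div P') + s" by (simp add: s_def)
    finally have x: "x = P' * r - P * s + P * P' * t" by (simp add: t_def algebra_simps)
    have "r \<noteq> 0" "s \<noteq> 0" using that x by (auto simp: dvd_add_left_iff)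
    then have b: "0 < r" "r < P" "0 < s" "s < P'"
      using pos by (auto simp: r_def s_def order_le_neq_trans)
    show ?thesis
    proof (cases "even t")
      case True
      then obtain j where "t = 2 * j" by blast
      then have "x = f ((r, s), j)" by (simp add: f_def x)
      then show ?thesis using b by force
    next
      case False
      then obtain i where "t = 2 * i + 1" by (elim oddE)
      then have "x = g ((P - r, s), - i - 1)" by (simp add: g_def x algebra_simps)
      moreover have "((P - r, s), - i - 1) \<in> ?B \<times> UNIV" using b by simp
      ultimately show ?thesis by blast
    qed
  qed
  have ndvd: "\<not> P dvd x \<and> \<not> P' dvd x" if "x \<in> f ` (?B \<times> UNIV) \<union> g ` (?B \<times> UNIV)" for x
  proof -
    from that obtain z where z: "z \<in> ?B \<times> UNIV" "x = f z \<or> x = g z" by blast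
    obtain r s j where "z = ((r, s), j)" by (metis prod.exhaust)
    with z have b: "0 < r" "r < P" "0 < s" "s < P'"
      and x: "x = 2 * P * P' * j + P' * r - P * s \<or> x = - (2 * P * P' * j + P' * r + P * s)"
      by (auto simp: f_def g_def)
    have "\<not> P dvd r" "\<not> P' dvd s" using b by (auto dest: zdvd_imp_le)
    then have 1: "\<not> P dvd P' * r" and 2: "\<not> P' dvd P * s"
      using cop cop' by (simp_all add: coprime_dvd_mult_right_iff)
    have "P dvd P' * r" if "P dvd x"
    proof -
      have "P' * r = x - P * (2 * P' * j - s) \<or> P' * r = - x - P * (2 * P' * j + s)"
        using x by (auto simp: algebra_simps)
      then show ?thesis using that by (metis dvd_diff dvd_minus_iff dvd_triv_left)
    qed
    moreover have "P' dvd P * s" if "P' dvd x"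
    proof -
      have "P * s = P' * (2 * P * j + r) - x \<or> P * s = - x - P' * (2 * P * j + r)"
        using x by (auto simp: algebra_simps)
      then show ?thesis using that by (metis dvd_diff dvd_minus_iff dvd_triv_left)
    qed
    ultimately show ?thesis using 1 2 by blast
  qed
  let ?F = "Sigma ?B (\<lambda>(r, s). {j. 2 * P * P' * j + P' * r - P * s \<in> X})"
  let ?G = "Sigma ?B (\<lambda>(r, s). {j. - (2 * P * P' * j + P' * r + P * s) \<in> X})"
  have F: "?F = {z \<in> ?B \<times> UNIV. f z \<in> X}" and G: "?G = {z \<in> ?B \<times> UNIV. g z \<in> X}"
    by (auto simp: f_def g_def)
  have finF: "finite ?F" unfolding F
    by (rule finite_imageD[OF finite_subset[OF _ X]]) (auto intro: inj_on_subset[OF inj_f])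
  have finG: "finite ?G" unfolding G
    by (rule finite_imageD[OF finite_subset[OF _ X]]) (auto intro: inj_on_subset[OF inj_g])
  have D: "?D = f ` ?F \<union> g ` ?G"
    unfolding F G
  proof (intro set_eqI iffI)
    fix x assume x: "x \<in> ?D"
    then have "x \<in> f ` (?B \<times> UNIV) \<union> g ` (?B \<times> UNIV)" using img by simp
    then obtain z where z: "z \<in> ?B \<times> UNIV" "x = f z \<or> x = g z" by blast
    have "x \<in> X" using x by simp
    from z(2) show "x \<in> f ` {z \<in> ?B \<times> UNIV. f z \<in> X} \<union> g ` {z \<in> ?B \<times> UNIV. g z \<in> X}"
    proof
      assume "x = f z"
      then show ?thesis using z(1) \<open>x \<in> X\<close> by (intro UnI1 image_eqI[of _ _ z]) simp_all
    next
      assume "x = g z"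
      then show ?thesis using z(1) \<open>x \<in> X\<close> by (intro UnI2 image_eqI[of _ _ z]) simp_all
    qed
  next
    fix x assume x: "x \<in> f ` {z \<in> ?B \<times> UNIV. f z \<in> X} \<union> g ` {z \<in> ?B \<times> UNIV. g z \<in> X}"
    then have "x \<in> f ` (?B \<times> UNIV) \<union> g ` (?B \<times> UNIV)" by (rule rev_subsetD) (intro Un_mono image_mono, auto)
    moreover have "x \<in> X" using x by (elim UnE imageE) simp_all
    ultimately show "x \<in> ?D" using ndvd by simp
  qed
  have fin_fibre:
    "finite {j. 2 * P * P' * j + P' * r - P * s \<in> X}" "finite {j. - (2 * P * P' * j + P' * r + P * s) \<in> X}"
    for r s
    using PP by (auto intro!: finite_vimageI[OF X, unfolded vimage_def] simp: inj_on_def)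
  have "(\<Sum>x\<in>?D. G x) = (\<Sum>x\<in>f ` ?F. G x) + (\<Sum>x\<in>g ` ?G. G x)"
    unfolding D
  proof (rule sum.union_disjoint)
    show "f ` ?F \<inter> g ` ?G = {}" using disj unfolding F G by fastforce
  qed (use finF finG in auto)
  also have "(\<Sum>x\<in>f ` ?F. G x) = (\<Sum>z\<in>?F. G (f z))"
    using inj_f unfolding F by (subst sum.reindex) (auto intro: inj_on_subset)
  also have "\<dots> = (\<Sum>(r, s)\<in>?B. \<Sum>j | 2 * P * P' * j + P' * r - P * s \<in> X.
      G (2 * P * P' * j + P' * r - P * s))"
    using sum.Sigma[of ?B "\<lambda>(r, s). {j. 2 * P * P' * j + P' * r - P * s \<in> X}" "\<lambda>z j. G (f (z, j))"] fin_fibre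
    by (simp add: f_def case_prod_unfold)
  also have "(\<Sum>x\<in>g ` ?G. G x) = (\<Sum>z\<in>?G. G (g z))"
    using inj_g unfolding G by (subst sum.reindex) (auto intro: inj_on_subset)
  also have "\<dots> = (\<Sum>(r, s)\<in>?B. \<Sum>j | - (2 * P * P' * j + P' * r + P * s) \<in> X.
      G (- (2 * P * P' * j + P' * r + P * s)))"
    using sum.Sigma[of ?B "\<lambda>(r, s). {j. - (2 * P * P' * j + P' * r + P * s) \<in> X}" "\<lambda>z j. G (g (z, j))"] fin_fibre
    by (simp add: g_def case_prod_unfold)
  finally show ?thesis by (simp add: sum.distrib[symmetric] case_prod_unfold)
qed

section \<open>Signed counting of the exponents\<close>

text \<open>
  A sequence of signs \<open>\<epsilon> k\<close> for the integers \<open>m k + d\<close> is continued by 0 to a function of all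
  integers.
\<close>

definition sign_at :: "int \<Rightarrow> int \<Rightarrow> (int \<Rightarrow> rat) \<Rightarrow> int \<Rightarrow> rat" where
  "sign_at m d \<epsilon> x = (if m dvd x - d then \<epsilon> ((x - d) div m) else 0)"

lemma sign_at_mult_add [simp]: "m \<noteq> 0 \<Longrightarrow> sign_at m d \<epsilon> (m * k + d) = \<epsilon> k"
  by (simp add: sign_at_def)

lemma sign_at_eq_0: "\<nexists>k. x = m * k + d \<Longrightarrow> sign_at m d \<epsilon> x = 0"
  unfolding sign_at_def dvd_def by (metis diff_add_cancel)

lemma sum_sign_at:
  assumes "m \<noteq> 0" "finite X"
  shows "(\<Sum>k | m * k + d \<in> X. \<epsilon> k) = (\<Sum>x\<in>X. sign_at m d \<epsilon> x)"
proof -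
  have "(\<Sum>k | m * k + d \<in> X. \<epsilon> k) = (\<Sum>k | m * k + d \<in> X. sign_at m d \<epsilon> (m * k + d))"
    using assms by simp
  also have "\<dots> = (\<Sum>x\<in>(\<lambda>k. m * k + d) ` {k. m * k + d \<in> X}. sign_at m d \<epsilon> x)"
    by (subst sum.reindex) (use assms in \<open>auto simp: inj_on_def\<close>)
  also have "\<dots> = (\<Sum>x\<in>X. sign_at m d \<epsilon> x)"
    using assms by (intro sum.mono_neutral_left) (auto intro!: sign_at_eq_0)
  finally show ?thesis .
qed

lemma sign_at_periodic:
  assumes "m \<noteq> 0" "\<And>k. \<epsilon> (k + l) = \<epsilon> k"
  shows "sign_at m d \<epsilon> (x + m * l) = sign_at m d \<epsilon> x"
proof -
  have "x + m * l - d = (x - d) + m * l" by simp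
  moreover have "((x - d) + m * l) div m = (x - d) div m + l"
    using assms(1) by simp
  moreover have "m dvd (x - d) + m * l \<longleftrightarrow> m dvd x - d"
    by (rule dvd_add_left_iff) simp
  ultimately show ?thesis unfolding sign_at_def by (simp only: assms(2))
qed

text \<open>
  The combinatorial core: \<open>X\<close> will be the set of those \<open>x\<close> that have a given exponent.
  The two sums on the left are combined into one sum over \<open>X\<close> of \<open>G x\<close>, where the \<open>x\<close> of the
  second kind are counted at \<open>- x\<close>, which has the same exponent. By the hypothesis on the signs
  the values of \<open>G\<close> at \<open>2 P P' j + P' r - P s\<close> and at \<open>- (2 P P' j + P' r + P s)\<close> are opposite and
  independent of \<open>j\<close>, so \<open>sum_over_coprime_residues\<close> gives the difference of the two numbers of
  \<open>j\<close> as the factor of a common sign.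

  A multiple of \<open>P\<close> is a multiple of 3 and cannot occur, because 3 does not divide \<open>a\<close>. A multiple
  of \<open>P'\<close> is a multiple of \<open>a\<close>, which forces \<open>c = 0\<close>; then both kinds of \<open>x\<close> coincide and their
  signs are opposite.
\<close>

lemma signed_exponent_count:
  fixes P P' a c n :: int and \<epsilon> \<epsilon>' :: "int \<Rightarrow> rat"
  assumes X: "finite X" "\<And>x. x \<in> X \<Longrightarrow> - x \<in> X"
    and cop: "coprime P P'" and pos: "P > 0" "P' > 0" "a > 0" and c: "0 \<le> c" "c < a"
    and dvd: "3 dvd P" "a dvd P'" and n: "P * P' = 3 * a * n"
    and per: "\<And>k j. \<epsilon> (k + n * j) = \<epsilon> k" "\<And>k j. \<epsilon>' (k + n * j) = \<epsilon>' k"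
    and sgn: "\<And>k t r s. P' * r = a * (6 * k + 1 + 3 * t) \<Longrightarrow> P * s = 3 * (c + a * t) \<Longrightarrow>
      \<epsilon>' (k + t) = - \<epsilon> k"
    and zero: "\<And>k i. c = 0 \<Longrightarrow> P' dvd a * (6 * i + 1) \<Longrightarrow> \<epsilon>' k = - \<epsilon> k"
  shows "(\<Sum>k | 6 * a * k + (a - 3 * c) \<in> X. \<epsilon> k) + (\<Sum>k | 6 * a * k + (a + 3 * c) \<in> X. \<epsilon>' k) =
    (\<Sum>(r, s)\<in>{0<..<P} \<times> {0<..<P'}.
      (sign_at (6 * a) (a - 3 * c) \<epsilon> (P' * r - P * s) - sign_at (6 * a) (a - 3 * c) \<epsilon> (- P' * r - P * s)) *
      (of_nat (card {j. 2 * P * P' * j + P' * r - P * s \<in> X}) -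
       of_nat (card {j. 2 * P * P' * j + P' * r + P * s \<in> X})))"
proof -
  let ?m = "6 * a"
  let ?g = "sign_at ?m (a - 3 * c) \<epsilon>" and ?h = "sign_at ?m (a + 3 * c) \<epsilon>'"
  define G where "G x = ?g x + ?h (- x)" for x
  have m: "?m \<noteq> 0" using pos by simp
  have not3: "\<not> 3 dvd a"
  proof
    assume "3 dvd a"
    then have "3 dvd P'" using dvd(2) by (rule dvd_trans)
    with cop dvd(1) have "is_unit (3 :: int)" by (rule coprime_common_divisor)
    then show False by simp
  qed
  have bij: "bij_betw uminus X X"
    by (rule bij_betw_byWitness[of _ uminus]) (use X(2) in auto)
  have "(\<Sum>k | ?m * k + (a - 3 * c) \<in> X. \<epsilon> k) + (\<Sum>k | ?m * k + (a + 3 * c) \<in> X. \<epsilon>' k) =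
      (\<Sum>x\<in>X. ?g x) + (\<Sum>x\<in>X. ?h x)"
    using sum_sign_at[OF m X(1)] by simp
  also have "(\<Sum>x\<in>X. ?h x) = (\<Sum>x\<in>X. ?h (- x))"
    by (rule sum.reindex_bij_betw[OF bij, symmetric])
  also have "(\<Sum>x\<in>X. ?g x) + (\<Sum>x\<in>X. ?h (- x)) = (\<Sum>x\<in>X. G x)"
    by (simp add: G_def sum.distrib)
  also have "\<dots> = (\<Sum>x | x \<in> X \<and> \<not> P dvd x \<and> \<not> P' dvd x. G x)
      + (\<Sum>x | x \<in> X \<and> (P dvd x \<or> P' dvd x). G x)"
    using X(1) by (subst sum.union_disjoint[symmetric]) (auto intro!: arg_cong[of _ _ "sum G"])
  also have "(\<Sum>x | x \<in> X \<and> (P dvd x \<or> P' dvd x). G x) = 0"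
  proof -
    let ?Z = "{x. x \<in> X \<and> (P dvd x \<or> P' dvd x)}"
    have "bij_betw uminus ?Z ?Z"
      by (rule bij_betw_byWitness[of _ uminus]) (use X(2) in auto)
    then have "(\<Sum>x\<in>?Z. ?h (- x)) = (\<Sum>x\<in>?Z. ?h x)" by (rule sum.reindex_bij_betw)
    then have "(\<Sum>x\<in>?Z. G x) = (\<Sum>x\<in>?Z. ?g x + ?h x)" by (simp add: G_def sum.distrib)
    also have "\<dots> = 0"
    proof (rule sum.neutral, safe)
      fix x assume "P dvd x"
      then have "3 dvd x" using dvd(1) dvd_trans by blast
      have "x \<noteq> ?m * k + (a + 3 * d)" for k d
      proof
        assume "x = ?m * k + (a + 3 * d)"
        then have "a = x - 3 * (2 * a * k + d)" by simp
        then have "3 dvd a" using \<open>3 dvd x\<close> by (metis dvd_diff dvd_triv_left)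
        with not3 show False by blast
      qed
      from this[of _ "- c"] this[of _ c] show "?g x + ?h x = 0"
        by (simp add: sign_at_eq_0)
    next
      fix x assume P': "P' dvd x"
      show "?g x + ?h x = 0"
      proof (cases "c = 0")
        case True
        show ?thesis
        proof (cases "\<exists>k. x = ?m * k + a")
          case True
          then obtain k where k: "x = ?m * k + a" by blast
          have "P' dvd a * (6 * k + 1)" using P' unfolding k by (simp add: algebra_simps)
          from zero[OF \<open>c = 0\<close> this] show ?thesis
            using sign_at_mult_add[OF m, of a _ k] unfolding k \<open>c = 0\<close> by simp
        next
          case False
          then show ?thesis using \<open>c = 0\<close> by (simp add: sign_at_eq_0)
        qed
      next
        case False
        have "x \<noteq> ?m * k + (a + 3 * d)" if "d = c \<or> d = - c" for k d
        proof
          assume "x = ?m * k + (a + 3 * d)"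
          then have "3 * d = x - a * (6 * k + 1)" by (simp add: algebra_simps)
          moreover have "a dvd x" using dvd(2) P' by (rule dvd_trans)
          ultimately have "a dvd 3 * d" by (metis dvd_diff dvd_triv_left)
          moreover have "coprime a 3"
            using not3 prime_imp_coprime[of 3 a] by (simp add: coprime_commute)
          ultimately have "a dvd d" by (simp add: coprime_dvd_mult_right_iff)
          then have "a dvd c" using that by auto
          then show False using c False by (auto dest: zdvd_imp_le)
        qed
        from this[of "- c"] this[of c] show ?thesis by (simp add: sign_at_eq_0)
      qed
    qed
    finally show ?thesis .
  qed
  also have "(\<Sum>x | x \<in> X \<and> \<not> P dvd x \<and> \<not> P' dvd x. G x) + 0 =
    (\<Sum>(r, s)\<in>{0<..<P} \<times> {0<..<P'}.
       (\<Sum>j | 2 * P * P' * j + P' * r - P * s \<in> X. G (2 * P * P' * j + P' * r - P * s)) +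
       (\<Sum>j | - (2 * P * P' * j + P' * r + P * s) \<in> X. G (- (2 * P * P' * j + P' * r + P * s))))"
    using sum_over_coprime_residues[OF cop pos(1,2) X(1), of G] by simp
  also have "\<dots> = (\<Sum>(r, s)\<in>{0<..<P} \<times> {0<..<P'}.
      (?g (P' * r - P * s) - ?g (- P' * r - P * s)) *
      (of_nat (card {j. 2 * P * P' * j + P' * r - P * s \<in> X}) -
       of_nat (card {j. 2 * P * P' * j + P' * r + P * s \<in> X})))"
  proof (rule sum.cong[OF refl], clarify)
    fix r s
    have two_n: "2 * P * P' * j = ?m * (n * j)" for j using n by simp
    have per': "?g (x + ?m * (n * j)) = ?g x" "?h (x + ?m * (n * j)) = ?h x" for x j
      by (rule sign_at_periodic[OF m], rule per)+
    \<comment> \<open>\<open>P' q - P s\<close> of the first kind with index \<open>k\<close> corresponds to \<open>P' q + P s\<close> of the second kind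
      with index \<open>k + t\<close>, where \<open>t\<close> is given by \<open>P s = 3 (c + a t)\<close>\<close>
    have reflect: "?h (P' * q + P * s) = - ?g (P' * q - P * s)" for q
    proof (cases "\<exists>k. P' * q - P * s = ?m * k + (a - 3 * c)")
      case True
      then obtain k where k: "P' * q - P * s = ?m * k + (a - 3 * c)" by blast
      obtain P0 P0' where P0: "P = 3 * P0" "P' = a * P0'" using dvd by blast
      have "3 * (P0 * s - c) = a * (P0' * q - 6 * k - 1)" using k by (simp add: P0 algebra_simps)
      then have "a dvd 3 * (P0 * s - c)" by simp
      moreover have "coprime a 3"
        using not3 prime_imp_coprime[of 3 a] by (simp add: coprime_commute)
      ultimately have "a dvd P0 * s - c" by (metis coprime_dvd_mult_right_iff)
      then obtain t where t: "P0 * s - c = a * t" by blast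
      have s: "P * s = 3 * (c + a * t)" using t by (simp add: P0 algebra_simps)
      have r: "P' * q = a * (6 * k + 1 + 3 * t)" using k s by (simp add: algebra_simps)
      have "P' * q + P * s = ?m * (k + t) + (a + 3 * c)" using r s by (simp add: algebra_simps)
      then have "?h (P' * q + P * s) = \<epsilon>' (k + t)" using m by simp
      also have "\<dots> = - \<epsilon> k" by (rule sgn[OF r s])
      also have "\<epsilon> k = ?g (P' * q - P * s)" unfolding k using m by simp
      finally show ?thesis .
    next
      case False
      have "\<nexists>k. P' * q + P * s = ?m * k + (a + 3 * c)"
      proof
        assume "\<exists>k. P' * q + P * s = ?m * k + (a + 3 * c)"
        then obtain k where k: "P' * q + P * s = ?m * k + (a + 3 * c)" by blast
        obtain P0 P0' where P0: "P = 3 * P0" "P' = a * P0'" using dvd by blast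
        have "3 * (P0 * s - c) = a * (6 * k + 1 - P0' * q)" using k by (simp add: P0 algebra_simps)
        then have "a dvd 3 * (P0 * s - c)" by simp
        moreover have "coprime a 3"
          using not3 prime_imp_coprime[of 3 a] by (simp add: coprime_commute)
        ultimately have "a dvd P0 * s - c" by (metis coprime_dvd_mult_right_iff)
        then obtain t where t: "P0 * s - c = a * t" by blast
        have "P * s = 3 * (c + a * t)" using t by (simp add: P0 algebra_simps)
        then have "P' * q - P * s = ?m * (k - t) + (a - 3 * c)" using k by (simp add: algebra_simps)
        with False show False by blast
      qed
      then show ?thesis using False by (simp add: sign_at_eq_0)
    qed
    have G1: "G (2 * P * P' * j + P' * r - P * s) = ?g (P' * r - P * s) - ?g (- P' * r - P * s)" for j
    proof -
      have 1: "2 * P * P' * j + P' * r - P * s = (P' * r - P * s) + ?m * (n * j)"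
        and 2: "- (2 * P * P' * j + P' * r - P * s) = (P' * (- r) + P * s) + ?m * (n * - j)"
        unfolding two_n by simp_all
      have "?h (- (2 * P * P' * j + P' * r - P * s)) = - ?g (P' * (- r) - P * s)"
        unfolding 2 per'(2) by (rule reflect)
      moreover have "?g (2 * P * P' * j + P' * r - P * s) = ?g (P' * r - P * s)"
        unfolding 1 by (rule per'(1))
      ultimately show ?thesis by (simp add: G_def)
    qed
    have G2: "G (- (2 * P * P' * j + P' * r + P * s)) = - (?g (P' * r - P * s) - ?g (- P' * r - P * s))" for j
    proof -
      have 1: "2 * P * P' * j + P' * r + P * s = (P' * r + P * s) + ?m * (n * j)"
        and 2: "- (2 * P * P' * j + P' * r + P * s) = (- P' * r - P * s) + ?m * (n * - j)"
        unfolding two_n by simp_all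
      have "?g (- (2 * P * P' * j + P' * r + P * s)) = ?g (- P' * r - P * s)"
        unfolding 2 by (rule per'(1))
      moreover have "?h (2 * P * P' * j + P' * r + P * s) = - ?g (P' * r - P * s)"
        unfolding 1 per'(2) by (rule reflect)
      ultimately show ?thesis unfolding G_def minus_minus by linarith
    qed
    have "- x \<in> X \<longleftrightarrow> x \<in> X" for x using X(2)[of x] X(2)[of "- x"] by auto
    then have J: "{j. - (2 * P * P' * j + P' * r + P * s) \<in> X} = {j. 2 * P * P' * j + P' * r + P * s \<in> X}"
      by (simp only:)
    show "(\<Sum>j | 2 * P * P' * j + P' * r - P * s \<in> X. G (2 * P * P' * j + P' * r - P * s)) +
       (\<Sum>j | - (2 * P * P' * j + P' * r + P * s) \<in> X. G (- (2 * P * P' * j + P' * r + P * s))) =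
       (?g (P' * r - P * s) - ?g (- P' * r - P * s)) *
      (of_nat (card {j. 2 * P * P' * j + P' * r - P * s \<in> X}) -
       of_nat (card {j. 2 * P * P' * j + P' * r + P * s \<in> X}))"
      unfolding G1 G2 J sum_constant by (simp add: algebra_simps)
  qed
  finally show ?thesis .
qed

section \<open>Operations on series with rational exponents\<close>

lemma rcoeff_diff [simp]: "rcoeff (f - g) e = rcoeff f e - rcoeff g e"
  unfolding minus_rser_def plus_rser.rep_eq uminus_rser.rep_eq by simp

lemma rcoeff_sum: "rcoeff (\<Sum>i\<in>A. f i) e = (\<Sum>i\<in>A. rcoeff (f i) e)"
  by (induction A rule: infinite_finite_induct) (auto simp: zero_rser.rep_eq plus_rser.rep_eq)

lemma rcoeff_qpow_times: "rcoeff (qpow a * f) e = rcoeff f (e - a)"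
proof -
  have "rcoeff (qpow a * f) e =
      (\<Sum>x\<in>{a}. \<Sum>y\<in>{e - a}. if x + y = e then rcoeff (qpow a) x * rcoeff f y else 0)"
    by (rule rcoeff_times_sum) (auto simp: qpow.rep_eq split: if_splits)
  then show ?thesis by (simp add: qpow.rep_eq)
qed

lemma rcoeff_rconst_times: "rcoeff (rconst c * f) e = c * rcoeff f e"
proof -
  have "rcoeff (rconst c * f) e =
      (\<Sum>x\<in>{0}. \<Sum>y\<in>{e}. if x + y = e then rcoeff (rconst c) x * rcoeff f y else 0)"
    by (rule rcoeff_times_sum) (auto simp: rconst.rep_eq split: if_splits)
  then show ?thesis by (simp add: rconst.rep_eq)
qed

lemma qpow_add: "qpow (a + b) = qpow a * (qpow b :: 'a::comm_ring_1 rser)"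
  by (rule rser_eqI) (simp add: rcoeff_qpow_times qpow.rep_eq eq_diff_eq add.commute)

lemma rcoeff_rser_of_fps:
  "rcoeff (rser_of_fps F) (of_nat m) = F $ m"
  "e \<notin> \<nat> \<Longrightarrow> rcoeff (rser_of_fps F) e = 0"
  by (simp_all add: rser_of_fps.rep_eq)

lemma rser_of_fps_mult: "rser_of_fps (F * G) = rser_of_fps F * rser_of_fps G"
proof (rule rser_eqI)
  fix e
  show "rcoeff (rser_of_fps (F * G)) e = rcoeff (rser_of_fps F * rser_of_fps G) e"
  proof (cases "e \<in> \<nat>")
    case True
    then obtain m where e: "e = of_nat m" by (auto elim: Nats_cases)
    let ?S = "(of_nat :: nat \<Rightarrow> rat) ` {0..m}"
    have inj: "inj_on (of_nat :: nat \<Rightarrow> rat) A" for A by (simp add: inj_on_def)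
    have "rcoeff (rser_of_fps F * rser_of_fps G) e = (\<Sum>x\<in>?S. \<Sum>y\<in>?S.
        if x + y = e then rcoeff (rser_of_fps F) x * rcoeff (rser_of_fps G) y else 0)"
    proof (rule rcoeff_times_sum)
      fix x y :: rat
      assume "rcoeff (rser_of_fps F) x \<noteq> 0" "rcoeff (rser_of_fps G) y \<noteq> 0" and xy: "x + y = e"
      then have "x \<in> \<nat>" "y \<in> \<nat>" using rcoeff_rser_of_fps(2) by blast+
      then obtain i j where ij: "x = of_nat i" "y = of_nat j" by (auto elim!: Nats_cases)
      then have "i + j = m" using xy e by (metis of_nat_add of_nat_eq_iff)
      then show "x \<in> ?S \<and> y \<in> ?S" unfolding ij by auto
    qed auto
    also have "\<dots> = (\<Sum>i=0..m. \<Sum>j=0..m. if i + j = m then F $ i * G $ j else 0)"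
      unfolding sum.reindex[OF inj] o_def rcoeff_rser_of_fps e
      by (simp only: of_nat_add[symmetric] of_nat_eq_iff)
    also have "\<dots> = (\<Sum>i=0..m. F $ i * G $ (m - i))"
    proof (rule sum.cong[OF refl])
      fix i assume i: "i \<in> {0..m}"
      have "(\<Sum>j=0..m. if i + j = m then F $ i * G $ j else 0) =
          (\<Sum>j=0..m. if j = m - i then F $ i * G $ j else 0)"
        using i by (intro sum.cong) auto
      then show "(\<Sum>j=0..m. if i + j = m then F $ i * G $ j else 0) = F $ i * G $ (m - i)"
        by simp
    qed
    also have "\<dots> = rcoeff (rser_of_fps (F * G)) e"
      unfolding e rcoeff_rser_of_fps fps_mult_nth ..
    finally show ?thesis by simp
  next
    case False
    have empty: "{x. rcoeff (rser_of_fps F) x \<noteq> 0 \<and> rcoeff (rser_of_fps G) (e - x) \<noteq> 0} = {}"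
    proof -
      have False if x: "rcoeff (rser_of_fps F) x \<noteq> 0" "rcoeff (rser_of_fps G) (e - x) \<noteq> 0" for x
      proof -
        have "x \<in> \<nat>" "e - x \<in> \<nat>" using x rcoeff_rser_of_fps(2) by blast+
        then have "x + (e - x) \<in> \<nat>" by (rule Nats_add)
        with False show False by simp
      qed
      then show ?thesis by blast
    qed
    show ?thesis unfolding rcoeff_times_raw empty using False by (simp add: rcoeff_rser_of_fps(2))
  qed
qed

lemma rcoeff_subst_pow: "n > 0 \<Longrightarrow> rcoeff (rser_subst_pow n f) e = rcoeff f (e / of_nat n)"
  by (simp add: rser_subst_pow.rep_eq)

lemma rser_subst_pow_mult:
  assumes "n > 0"
  shows "rser_subst_pow n (f * g) = rser_subst_pow n f * rser_subst_pow n g"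
proof (rule rser_eqI)
  fix e
  show "rcoeff (rser_subst_pow n (f * g)) e = rcoeff (rser_subst_pow n f * rser_subst_pow n g) e"
    unfolding rcoeff_subst_pow[OF assms] rcoeff_times_raw
    using assms
    by (intro sum.reindex_bij_witness[of _ "\<lambda>x. x / of_nat n" "\<lambda>x. x * of_nat n"])
      (auto simp: diff_divide_distrib)
qed

lemma rser_subst_pow_diff:
  "n > 0 \<Longrightarrow> rser_subst_pow n (f - g) = rser_subst_pow n f - rser_subst_pow n g"
  by (rule rser_eqI) (simp add: rcoeff_subst_pow)

lemma rser_subst_pow_qpow: "n > 0 \<Longrightarrow> rser_subst_pow n (qpow a) = qpow (of_nat n * a)"
  by (rule rser_eqI) (auto simp: rcoeff_subst_pow qpow.rep_eq field_simps)

lemma fps_compose_X_power_nth: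
  assumes "n > 0"
  shows "(F oo fps_X ^ n) $ m = (if n dvd m then F $ (m div n) else (0 :: 'a::comm_ring_1))"
proof -
  have "(F oo fps_X ^ n) $ m = (\<Sum>i=0..m. if n dvd m \<and> i = m div n then F $ i else 0)"
    unfolding fps_compose_nth power_mult[symmetric] fps_X_power_nth using assms
    by (intro sum.cong) auto
  also have "\<dots> = (if n dvd m then F $ (m div n) else 0)"
    by (auto simp: div_le_dividend)
  finally show ?thesis .
qed

lemma rser_subst_pow_of_fps:
  assumes "n > 0"
  shows "rser_subst_pow n (rser_of_fps F) = rser_of_fps (F oo fps_X ^ n)"
proof (rule rser_eqI)
  fix e :: rat
  have iff: "e / of_nat n \<in> \<nat> \<longleftrightarrow> (\<exists>m. e = of_nat (n * m))"
    using assms by (auto simp: field_simps elim!: Nats_cases)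
  show "rcoeff (rser_subst_pow n (rser_of_fps F)) e = rcoeff (rser_of_fps (F oo fps_X ^ n)) e"
  proof (cases "e / of_nat n \<in> \<nat>")
    case True
    then obtain m where e: "e = of_nat (n * m)" using iff by blast
    then have "e / of_nat n = of_nat m" using assms by simp
    then show ?thesis
      using assms unfolding rcoeff_subst_pow[OF assms]
      by (simp only: rcoeff_rser_of_fps e fps_compose_X_power_nth) simp
  next
    case False
    have "rcoeff (rser_of_fps (F oo fps_X ^ n)) e = 0"
    proof (cases "e \<in> \<nat>")
      case True
      then obtain k where k: "e = of_nat k" by (auto elim: Nats_cases)
      have "\<not> n dvd k" using False iff k by (auto elim!: dvdE)
      then show ?thesis unfolding k rcoeff_rser_of_fps fps_compose_X_power_nth[OF assms] by simp
    qed (simp add: rcoeff_rser_of_fps)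
    then show ?thesis using False by (simp add: rcoeff_subst_pow[OF assms] rcoeff_rser_of_fps)
  qed
qed

lemma qpoch_compose_X_power:
  fixes n :: nat
  assumes "n > 0"
  shows "qpoch [fps_X] fps_X oo fps_X ^ n = (qpoch [fps_X ^ n] (fps_X ^ n) :: 'a::idom fps)"
proof (rule agree_all_imp_eq)
  fix N
  let ?Y = "fps_X ^ n :: 'a fps"
  have Y: "?Y $ 0 = 0" using assms by simp
  let ?p = "\<lambda>v :: 'a fps. \<Prod>i<N. 1 - v * v ^ i"
  have "agree N (qpoch [fps_X] fps_X) (?p fps_X)"
    using agree_qpoch[of "fps_X :: 'a fps" N "[fps_X]"] by simp
  then have "agree N (qpoch [fps_X] fps_X oo ?Y) (?p fps_X oo ?Y)"
    unfolding agree_def fps_compose_X_power_nth[OF assms]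
    using le_less_trans[OF div_le_dividend] by auto
  also have "?p fps_X oo ?Y = ?p ?Y"
    using Y by (simp add: fps_compose_prod_distrib fps_compose_sub_distrib fps_compose_mult_distrib
        fps_compose_power[symmetric])
  also have "agree N \<dots> (qpoch [?Y] ?Y)"
    using agree_qpoch[OF Y, of N "[?Y]"] by (simp add: agree_sym)
  finally show "agree N (qpoch [fps_X] fps_X oo ?Y) (qpoch [?Y] ?Y)" .
qed

lemma rcoeff_formal_sum_monomials:
  assumes "\<And>m. finite {j. E j = m}"
  shows "rcoeff (rser_of_fps (formal_sum (\<lambda>j. fps_const (\<epsilon> j) * fps_X ^ E j) UNIV)) e =
    (\<Sum>j | of_nat (E j) = e. \<epsilon> j)"
proof (cases "e \<in> \<nat>")
  case True
  then obtain m where e: "e = of_nat m" by (auto elim: Nats_cases)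
  have "formal_sum (\<lambda>j. fps_const (\<epsilon> j) * fps_X ^ E j) UNIV $ m =
      (\<Sum>j | E j = m. (fps_const (\<epsilon> j) * fps_X ^ E j) $ m)"
    by (rule formal_sum_nth) (use assms in auto)
  then show ?thesis by (simp add: e rcoeff_rser_of_fps)
next
  case False
  then have "{j. of_nat (E j) = e} = {}" by auto
  then show ?thesis using False by (simp add: rcoeff_rser_of_fps)
qed

lemma rser_of_fps_add: "rser_of_fps (F + G) = rser_of_fps F + rser_of_fps G"
  by (rule rser_eqI) (simp add: rser_of_fps.rep_eq plus_rser.rep_eq)

section \<open>The sum of characters as a signed theta series\<close>

text \<open>
  The factor \<open>1 / (q)\<^sub>\<infinity>\<close> and the power of \<open>q\<close> in front do not depend on the labels, so they can be
  taken out of the sum of characters.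
\<close>

lemma subst_minimal_character:
  assumes "n > 0"
  shows "rser_subst_pow n (minimal_character p p' r s) =
    rser_of_fps (inverse (qpoch [fps_X ^ n] (fps_X ^ n))) *
    (qpow (- (of_nat n * (of_int ((int p' - int p)\<^sup>2) / of_nat (4 * p * p')))) *
      (rser_subst_pow n (theta_sum (\<lambda>j. of_int ((2 * int p * int p' * j + int p' * r - int p * s)\<^sup>2) / of_nat (4 * p * p')))
       - rser_subst_pow n (theta_sum (\<lambda>j. of_int ((2 * int p * int p' * j + int p' * r + int p * s)\<^sup>2) / of_nat (4 * p * p')))))"
proof -
  have "inverse (qpoch [fps_X] fps_X) oo fps_X ^ n = (inverse (qpoch [fps_X ^ n] (fps_X ^ n)) :: rat fps)"
    using assms by (simp add: fps_inverse_compose qpoch_compose_X_power qpoch_singleton_nth_0)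
  then show ?thesis
    unfolding minimal_character_def
    by (simp add: assms rser_subst_pow_mult rser_subst_pow_diff rser_subst_pow_qpow rser_subst_pow_of_fps
        mult.left_commute mult.assoc)
qed

lemma rcoeff_subst_theta_sum:
  assumes "n > 0" "a > 0" "d > 0"
  shows "rcoeff (rser_subst_pow n (theta_sum (\<lambda>j. of_int ((int a * j + k)\<^sup>2) / of_nat d)) :: rat rser) e =
    of_nat (card {j. of_nat n * (of_int ((int a * j + k)\<^sup>2) / of_nat d) = e})"
  unfolding rcoeff_subst_pow[OF assms(1)]
  using assms(1) by (subst rcoeff_theta_sum[OF finite_theta_exponents[OF assms(2,3)]])
    (simp add: field_simps)

lemma finite_int_square_eq: "finite {x :: int. of_int (x\<^sup>2) * B = (e :: rat)}" if "B > 0"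
proof (rule finite_subset)
  show "finite {x :: int. of_int ((int 1 * x + 0)\<^sup>2) / of_nat 1 \<le> e / B}"
    by (rule finite_theta_exponents) auto
  show "{x :: int. of_int (x\<^sup>2) * B = e} \<subseteq> {x. of_int ((int 1 * x + 0)\<^sup>2) / of_nat 1 \<le> e / B}"
    using that by (auto simp: field_simps)
qed

text \<open>
  The coefficients of both sides are compared at a fixed exponent. With \<open>p = b P\<close>, \<open>p' = b' P'\<close>
  and \<open>p p' = 3 a' B n\<close>, the \<open>j\<close>-th exponent of a character becomes, after the substitution of
  \<open>q\<^sup>n\<close> for \<open>q\<close>, the number \<open>B x\<^sup>2 / (12 a')\<close> with \<open>x = 2 P P' j + P' r \<mp> P s\<close>; and completing the
  square gives the same form, up to the constant \<open>\<delta>\<close>, to the exponents of the quintuple product.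
  What remains is the statement of \<open>signed_exponent_count\<close>.
\<close>

lemma character_sum_eq_signed_theta:
  fixes p p' a' b b' c B n :: nat and \<epsilon> \<epsilon>' :: "int \<Rightarrow> rat"
  assumes cop: "coprime p p'" and p: "p > 1" "p' > 1" and a': "a' > 0" and b: "b > 0" "b' > 0"
    and c: "a' > c" and dvd: "3 * b dvd p" "a' * b' dvd p'"
    and B: "B = b * b'" and n: "n = p * p' div (3 * a' * b * b')"
    and \<epsilon>: "\<And>f. (- 1) powi \<sigma> f = \<epsilon> f"
    and per: "\<And>k j. \<epsilon> (k + int n * j) = \<epsilon> k" "\<And>k j. \<epsilon>' (k + int n * j) = \<epsilon>' k"
    and sgn: "\<And>k t r s. int (p' div b') * r = int a' * (6 * k + 1 + 3 * t) \<Longrightarrow>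
      int (p div b) * s = 3 * (int c + int a' * t) \<Longrightarrow> \<epsilon>' (k + t) = - \<epsilon> k"
    and zero: "\<And>k i. c = 0 \<Longrightarrow> int (p' div b') dvd int a' * (6 * i + 1) \<Longrightarrow> \<epsilon>' k = - \<epsilon> k"
  shows "character_sum \<sigma> n p p' a' b b' c =
    rser_of_fps (inverse (qpoch [fps_X ^ n] (fps_X ^ n))) * rser_of_fps
      (formal_sum (\<lambda>j. fps_const (\<epsilon> j) * fps_X ^ (B * c * nat (3 * j\<^sup>2 - 2 * j) + 2 * B * (a' - c) * pent j)) UNIV +
       formal_sum (\<lambda>j. fps_const (\<epsilon>' j) * fps_X ^ (B * c * nat (3 * j\<^sup>2 + 4 * j + 1) + 2 * B * (a' - c) * pent j)) UNIV)"
proof -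
  define P where "P = p div b"
  define P' where "P' = p' div b'"
  have pP: "p = b * P" "p' = b' * P'"
    using dvd by (auto simp: P_def P'_def dest: dvd_mult_right dvd_mult_left)
  have P3: "3 dvd P" "a' dvd P'" using dvd b by (auto simp: pP mult.commute)
  have pos: "P > 0" "P' > 0" "B > 0" using p b by (auto simp: pP B intro!: gr0I)
  have PPn: "P * P' = 3 * a' * n"
  proof -
    have "3 * a' dvd P * P'" using P3 by (rule mult_dvd_mono)
    moreover have "n = (b * b') * (P * P') div ((b * b') * (3 * a'))"
      unfolding n pP by (simp add: ac_simps)
    ultimately show ?thesis using b by simp
  qed
  have n0: "n > 0" using PPn pos by (cases n) auto
  have ppn: "p * p' = 3 * a' * B * n" using PPn by (simp add: pP B)
  define \<delta> :: rat where "\<delta> = - (of_nat B * of_int ((int a' - 3 * int c)\<^sup>2) / of_nat (12 * a'))"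
  have \<delta>: "of_int ((int p - int p')\<^sup>2 - (int a' - 3 * int c)\<^sup>2 * (int (b * b'))\<^sup>2) / of_nat (12 * (b * b') * a')
      + - (of_nat n * (of_int ((int p' - int p)\<^sup>2) / of_nat (4 * p * p'))) = \<delta>"
  proof -
    have 1: "(of_nat (4 * p * p') :: rat) = of_nat n * of_nat (12 * B * a')"
      using arg_cong[OF ppn, of "\<lambda>x. 4 * (of_nat x :: rat)"] by (simp add: ac_simps)
    have 2: "of_nat n * ((y :: rat) / of_nat (4 * p * p')) = y / of_nat (12 * B * a')" for y
      unfolding 1 using n0 pos a' by simp
    have 3: "of_int (D - A * (int B)\<^sup>2) / of_nat (12 * B * a') + - (of_int D / of_nat (12 * B * a')) =
        - (of_nat B * of_int A / of_nat (12 * a') :: rat)" for D A :: int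
      using pos a' by (simp add: field_simps power2_eq_square)
    show ?thesis
      unfolding 2 B[symmetric] \<delta>_def power2_commute[of "int p'" "int p"] by (rule 3)
  qed
  define K :: "int \<times> int \<Rightarrow> rat rser" where "K = (\<lambda>(r, s).
    rser_subst_pow n (theta_sum (\<lambda>j. of_int ((2 * int p * int p' * j + int p' * (r * int b) - int p * (s * int b'))\<^sup>2) / of_nat (4 * p * p')))
    - rser_subst_pow n (theta_sum (\<lambda>j. of_int ((2 * int p * int p' * j + int p' * (r * int b) + int p * (s * int b'))\<^sup>2) / of_nat (4 * p * p'))))"
  let ?sg = "\<lambda>z. rconst ((- 1) powi \<sigma> (sign_exp p p' a' b b' c z)) :: rat rser"
  let ?A1 = "A1 p p' a' b b' c" and ?A2 = "A2 p p' a' b b' c"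
  let ?I = "rser_of_fps (inverse (qpoch [fps_X ^ n] (fps_X ^ n))) :: rat rser"
  let ?q = "qpow (- (of_nat n * (of_int ((int p' - int p)\<^sup>2) / of_nat (4 * p * p')))) :: rat rser"
  have factor: "(\<Sum>(r, s)\<in>A. ?sg (r, s) * rser_subst_pow n (minimal_character p p' (r * int b) (s * int b'))) =
      ?I * (?q * (\<Sum>z\<in>A. ?sg z * K z))" for A
    unfolding sum_distrib_left subst_minimal_character[OF n0] K_def
    by (rule sum.cong) (simp_all add: case_prod_unfold mult.left_commute)
  have cs: "character_sum \<sigma> n p p' a' b b' c =
      ?I * (qpow \<delta> * ((\<Sum>z\<in>?A1. ?sg z * K z) - (\<Sum>z\<in>?A2. ?sg z * K z)))"
    unfolding character_sum_def factor \<delta>[symmetric] qpow_add by (simp add: algebra_simps)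
  define E1 where "E1 j = B * c * nat (3 * j\<^sup>2 - 2 * j) + 2 * B * (a' - c) * pent j" for j :: int
  define E2 where "E2 j = B * c * nat (3 * j\<^sup>2 + 4 * j + 1) + 2 * B * (a' - c) * pent j" for j :: int
  let ?a = "int a'" and ?c = "int c"
  have ac: "int (a' - c) = ?a - ?c" using c by simp
  have E1: "(of_nat (E1 j) :: rat) = of_int ((6 * ?a * j + (?a - 3 * ?c))\<^sup>2) * (of_nat B / of_nat (12 * a')) + \<delta>" for j
  proof -
    have eq: "int (E1 j) = int B * (?c * (3 * j\<^sup>2 - 2 * j) + (?a - ?c) * (j * (3 * j + 1)))"
      unfolding E1_def two_pent[symmetric] of_nat_add of_nat_mult ac
      using quintuple_exponents_nonneg[of j] by (simp add: algebra_simps)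
    have "12 * ?a * int (E1 j) = int B * ((6 * ?a * j + (?a - 3 * ?c))\<^sup>2 - (?a - 3 * ?c)\<^sup>2)"
      unfolding eq by (simp add: algebra_simps power2_eq_square)
    then have "(of_int (12 * ?a * int (E1 j)) :: rat) =
        of_int (int B * ((6 * ?a * j + (?a - 3 * ?c))\<^sup>2 - (?a - 3 * ?c)\<^sup>2))" by (simp only:)
    then show ?thesis unfolding \<delta>_def using a' by (simp add: field_simps)
  qed
  have E2: "(of_nat (E2 j) :: rat) = of_int ((6 * ?a * j + (?a + 3 * ?c))\<^sup>2) * (of_nat B / of_nat (12 * a')) + \<delta>" for j
  proof -
    have eq: "int (E2 j) = int B * (?c * (3 * j\<^sup>2 + 4 * j + 1) + (?a - ?c) * (j * (3 * j + 1)))"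
      unfolding E2_def two_pent[symmetric] of_nat_add of_nat_mult ac
      using quintuple_exponents_nonneg[of j] by (simp add: algebra_simps)
    have "12 * ?a * int (E2 j) = int B * ((6 * ?a * j + (?a + 3 * ?c))\<^sup>2 - (?a - 3 * ?c)\<^sup>2)"
      unfolding eq by (simp add: algebra_simps power2_eq_square)
    then have "(of_int (12 * ?a * int (E2 j)) :: rat) =
        of_int (int B * ((6 * ?a * j + (?a + 3 * ?c))\<^sup>2 - (?a - 3 * ?c)\<^sup>2))" by (simp only:)
    then show ?thesis unfolding \<delta>_def using a' by (simp add: field_simps)
  qed
  define X where "X e = {x :: int. of_int (x\<^sup>2) * (of_nat B / of_nat (12 * a')) = (e :: rat)}" for e
  have finX: "finite (X e)" for e
    unfolding X_def using pos a' by (intro finite_int_square_eq) simp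
  have X1: "of_nat (E1 j) = e \<longleftrightarrow> 6 * ?a * j + (?a - 3 * ?c) \<in> X (e - \<delta>)"
    and X2: "of_nat (E2 j) = e \<longleftrightarrow> 6 * ?a * j + (?a + 3 * ?c) \<in> X (e - \<delta>)" for j e
    unfolding E1 E2 X_def by (auto simp del: of_int_power)
  have fib: "finite {j. E1 j = m}" "finite {j. E2 j = m}" for m
  proof -
    have "{j. E1 j = m} = {j. 6 * ?a * j + (?a - 3 * ?c) \<in> X (of_nat m - \<delta>)}"
      "{j. E2 j = m} = {j. 6 * ?a * j + (?a + 3 * ?c) \<in> X (of_nat m - \<delta>)}"
      unfolding X1[symmetric] X2[symmetric] by simp_all
    then show "finite {j. E1 j = m}" "finite {j. E2 j = m}"
      using a' by (auto intro!: finite_vimageI[OF finX, unfolded vimage_def] simp: inj_on_def)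
  qed
  let ?box = "{0<..<int P} \<times> {0<..<int P'}"
  let ?J = "\<lambda>r s e. {j. 2 * int P * int P' * j + int P' * r - int P * s \<in> X e}"
  let ?J' = "\<lambda>r s e. {j. 2 * int P * int P' * j + int P' * r + int P * s \<in> X e}"
  let ?sat = "sign_at (6 * ?a) (?a - 3 * ?c) \<epsilon>"
  have K: "rcoeff (K (r, s)) e = of_nat (card (?J r s e)) - of_nat (card (?J' r s e))" for r s e
  proof -
    have 1: "of_nat n * (of_int (y\<^sup>2) / of_nat (4 * p * p')) = e \<longleftrightarrow> x \<in> X e"
      if "y = int B * x" for x y
    proof -
      have d: "(of_nat (4 * p * p') :: rat) = of_nat n * of_nat B * of_nat (12 * a')"
        using arg_cong[OF ppn, of "\<lambda>x. 4 * (of_nat x :: rat)"] by (simp add: ac_simps)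
      have "of_nat n * (of_int (y\<^sup>2) / of_nat (4 * p * p')) =
          of_int (x\<^sup>2) * (of_nat B / of_nat (12 * a') :: rat)"
        unfolding that d using n0 pos a' by (simp add: power_mult_distrib power2_eq_square)
      then show ?thesis by (simp add: X_def)
    qed
    have y: "int (2 * p * p') * j + (int p' * (r * int b) + int p * (t * int b')) =
        int B * (2 * int P * int P' * j + int P' * r + int P * t)" for j t
      by (simp add: pP B algebra_simps)
    have th: "rcoeff (rser_subst_pow n (theta_sum (\<lambda>j. of_int ((int (2 * p * p') * j + (int p' * (r * int b) + int p * (t * int b')))\<^sup>2)
        / of_nat (4 * p * p'))) :: rat rser) e =
        of_nat (card {j. 2 * int P * int P' * j + int P' * r + int P * t \<in> X e})" for t
    proof -
      have "2 * p * p' > 0" "4 * p * p' > 0" using p by auto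
      from rcoeff_subst_theta_sum[OF n0 this] show ?thesis by (simp only: 1[OF y])
    qed
    show ?thesis
      using th[of s] th[of "- s"] by (simp add: K_def add_diff_eq add.assoc)
  qed
  \<comment> \<open>for a common element 3 would divide \<open>P' r\<close> as well as \<open>P' r - a'\<close>, hence \<open>a'\<close> and \<open>P'\<close>\<close>
  have disj: "?A1 \<inter> ?A2 = {}"
  proof -
    have False if z: "(r, s) \<in> ?A1" "(r, s) \<in> ?A2" for r s
    proof -
      have 1: "6 * ?a dvd int P' * r - int P * s - ?a + 3 * ?c"
        and 2: "6 * ?a dvd int P' * r + int P * s + ?a - 3 * ?c"
        using z by (simp_all add: A1_def A2_def P_def P'_def)
      have "6 * ?a dvd 2 * (int P' * r)" using dvd_add[OF 1 2] by (simp add: mult.commute)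
      then have "6 dvd 2 * (int P' * r)" by (rule dvd_mult_left)
      then have "3 dvd int P' * r" by presburger
      moreover have "3 dvd int P * s" using P3(1) by (auto elim!: dvdE)
      moreover have "3 dvd int P' * r - int P * s - ?a + 3 * ?c"
        using dvd_trans[OF _ 1, of 3] by simp
      ultimately have "3 dvd ?a" by presburger
      then have "3 dvd a'" by presburger
      then have "3 dvd P'" using P3(2) dvd_trans by blast
      moreover have "coprime P P'" using cop by (simp add: pP)
      ultimately have "is_unit (3 :: nat)" using P3(1) coprime_common_divisor by blast
      then show False by simp
    qed
    then show ?thesis by auto
  qed
  have s1: "(\<Sum>z\<in>?A1. (- 1) powi \<sigma> (sign_exp p p' a' b b' c z) * rcoeff (K z) e) =
      (\<Sum>(r, s)\<in>?box. ?sat (int P' * r - int P * s) * rcoeff (K (r, s)) e)" for e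
  proof (rule sum.mono_neutral_cong_left)
    have e: "int P' * r - int P * s - ?a + 3 * ?c = int P' * r - int P * s - (?a - 3 * ?c)" for r s
      by simp
    have mem: "(r, s) \<in> ?A1 \<longleftrightarrow> (r, s) \<in> ?box \<and> 6 * ?a dvd int P' * r - int P * s - (?a - 3 * ?c)" for r s
      unfolding A1_def P_def[symmetric] P'_def[symmetric] e by auto
    show "?A1 \<subseteq> ?box" using mem by auto
    show "\<forall>z\<in>?box - ?A1. (case z of (r, s) \<Rightarrow> ?sat (int P' * r - int P * s) * rcoeff (K (r, s)) e) = 0"
      unfolding sign_at_def using mem by (simp add: Ball_def)
    fix z assume z: "z \<in> ?A1"
    obtain r s where rs: "z = (r, s)" by (cases z)
    show "(- 1) powi \<sigma> (sign_exp p p' a' b b' c z) * rcoeff (K z) e =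
        (case z of (r, s) \<Rightarrow> ?sat (int P' * r - int P * s) * rcoeff (K (r, s)) e)"
      using z mem[of r s] unfolding rs prod.case sign_at_def sign_exp_def P_def[symmetric] P'_def[symmetric] e
      by (simp only: if_True simp_thms \<epsilon>)
  qed simp
  have s2: "(\<Sum>z\<in>?A2. (- 1) powi \<sigma> (sign_exp p p' a' b b' c z) * rcoeff (K z) e) =
      (\<Sum>(r, s)\<in>?box. ?sat (- int P' * r - int P * s) * rcoeff (K (r, s)) e)" for e
  proof (rule sum.mono_neutral_cong_left)
    have neg: "6 * ?a dvd int P' * r + int P * s + ?a - 3 * ?c \<longleftrightarrow>
        6 * ?a dvd - int P' * r - int P * s - (?a - 3 * ?c)" for r s
      using dvd_minus_iff[of "6 * ?a" "int P' * r + int P * s + ?a - 3 * ?c"]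
      by (simp add: algebra_simps)
    have mem: "(r, s) \<in> ?A2 \<longleftrightarrow> (r, s) \<in> ?box \<and> 6 * ?a dvd - int P' * r - int P * s - (?a - 3 * ?c)" for r s
      unfolding A2_def P_def[symmetric] P'_def[symmetric] neg by auto
    have e: "- int P' * r - int P * s - ?a + 3 * ?c = - int P' * r - int P * s - (?a - 3 * ?c)" for r s
      by simp
    show "?A2 \<subseteq> ?box" using mem by auto
    show "\<forall>z\<in>?box - ?A2. (case z of (r, s) \<Rightarrow> ?sat (- int P' * r - int P * s) * rcoeff (K (r, s)) e) = 0"
      unfolding sign_at_def using mem by (simp add: Ball_def)
    fix z assume z: "z \<in> ?A2"
    obtain r s where rs: "z = (r, s)" by (cases z)
    have "(r, s) \<notin> ?A1" using disj z rs by auto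
    then show "(- 1) powi \<sigma> (sign_exp p p' a' b b' c z) * rcoeff (K z) e =
        (case z of (r, s) \<Rightarrow> ?sat (- int P' * r - int P * s) * rcoeff (K (r, s)) e)"
      using z mem[of r s] unfolding rs prod.case sign_at_def sign_exp_def P_def[symmetric] P'_def[symmetric] e
      by (simp only: if_True if_False simp_thms \<epsilon>)
  qed simp
  have "rser_of_fps (formal_sum (\<lambda>j. fps_const (\<epsilon> j) * fps_X ^ E1 j) UNIV +
       formal_sum (\<lambda>j. fps_const (\<epsilon>' j) * fps_X ^ E2 j) UNIV) =
      qpow \<delta> * ((\<Sum>z\<in>?A1. ?sg z * K z) - (\<Sum>z\<in>?A2. ?sg z * K z))" (is "?l = ?r")
  proof (rule rser_eqI)
    fix e
    let ?X = "X (e - \<delta>)"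
    have "rcoeff ?r e = (\<Sum>(r, s)\<in>?box. (?sat (int P' * r - int P * s) - ?sat (- int P' * r - int P * s)) *
        (of_nat (card (?J r s (e - \<delta>))) - of_nat (card (?J' r s (e - \<delta>)))))"
      unfolding rcoeff_qpow_times rcoeff_diff rcoeff_sum rcoeff_rconst_times s1 s2
      unfolding case_prod_unfold sum_subtractf[symmetric] K[symmetric] left_diff_distrib
      by (simp add: case_prod_unfold)
    also have "\<dots> = (\<Sum>k | 6 * ?a * k + (?a - 3 * ?c) \<in> ?X. \<epsilon> k) + (\<Sum>k | 6 * ?a * k + (?a + 3 * ?c) \<in> ?X. \<epsilon>' k)"
    proof (rule signed_exponent_count[symmetric, of ?X "int P" "int P'" ?a ?c "int n"])
      show "finite ?X" by (rule finX)
      show "- x \<in> ?X" if "x \<in> ?X" for x using that by (simp add: X_def)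
      show "coprime (int P) (int P')" using cop by (simp add: pP)
      show "int P * int P' = 3 * ?a * int n" using arg_cong[OF PPn, of int] by simp
      show "\<epsilon>' (k + t) = - \<epsilon> k" if "int P' * r = ?a * (6 * k + 1 + 3 * t)" "int P * s = 3 * (?c + ?a * t)"
        for k t r s using sgn[of r k t s] that by (simp add: P_def P'_def)
      show "\<epsilon>' k = - \<epsilon> k" if "?c = 0" "int P' dvd ?a * (6 * i + 1)" for k i
        using zero[of i k] that by (simp add: P'_def)
    qed (use pos a' c per P3 in \<open>auto simp: int_dvd_int_iff[of 3, simplified]\<close>)
    also have "\<dots> = rcoeff ?l e"
      unfolding rser_of_fps_add plus_rser.rep_eq rcoeff_formal_sum_monomials[of E1, OF fib(1)]
        rcoeff_formal_sum_monomials[of E2, OF fib(2)] X1 X2 ..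
    finally show "rcoeff ?l e = rcoeff ?r e" ..
  qed
  then show ?thesis unfolding cs E1_def E2_def by simp
qed

section \<open>The three specializations of the quintuple product\<close>

text \<open>
  The quintuple product for \<open>u = s q\<^bsup>B c\<^esup>\<close> and \<open>v = t q\<^bsup>2 B (a - c)\<^esup>\<close>. The three identities use the
  signs \<open>(s, t) = (1, 1)\<close>, \<open>(-1, -1)\<close> and \<open>(1, -1)\<close>.
\<close>

lemma quintuple_product_monomials:
  fixes a c B :: nat and s t :: "'a::field_char_0"
  assumes "c < a" "B > 0"
  shows "qpoch [- (fps_const s * fps_X ^ (B * c)), - (fps_const (s * t) * fps_X ^ (B * (2 * a - c))),
        fps_const (s\<^sup>2 * t) * fps_X ^ (2 * B * a)] (fps_const (s\<^sup>2 * t) * fps_X ^ (2 * B * a)) *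
      qpoch [fps_const (s ^ 4 * t) * fps_X ^ (2 * B * (a + c)), fps_const t * fps_X ^ (2 * B * (a - c))]
        (fps_const (s ^ 4 * t\<^sup>2) * fps_X ^ (4 * B * a)) =
    formal_sum (\<lambda>j. fps_const (alt j * s ^ nat (3 * j\<^sup>2 - 2 * j) * t ^ pent j) *
      fps_X ^ (B * c * nat (3 * j\<^sup>2 - 2 * j) + 2 * B * (a - c) * pent j)) UNIV +
    formal_sum (\<lambda>j. fps_const (alt j * s ^ nat (3 * j\<^sup>2 + 4 * j + 1) * t ^ pent j) *
      fps_X ^ (B * c * nat (3 * j\<^sup>2 + 4 * j + 1) + 2 * B * (a - c) * pent j)) UNIV"
proof -
  define u where "u = fps_const s * fps_X ^ (B * c)"
  define v where "v = fps_const t * fps_X ^ (2 * B * (a - c))"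
  obtain d where a: "a = c + d" and d: "d > 0" using assms(1) by (metis less_imp_add_positive)
  have mono: "u ^ i * v ^ j = fps_const (s ^ i * t ^ j) * fps_X ^ (B * c * i + 2 * B * (a - c) * j)" for i j
    unfolding u_def v_def power_mult_distrib fps_const_power power_add power_mult[symmetric] fps_const_mult[symmetric]
    by (simp only: ac_simps)
  have uv: "u * v = fps_const (s * t) * fps_X ^ (B * (2 * a - c))"
    using mono[of 1 1] by (simp add: a algebra_simps)
  have Q: "u\<^sup>2 * v = fps_const (s\<^sup>2 * t) * fps_X ^ (2 * B * a)"
    using mono[of 2 1] by (simp add: a algebra_simps)
  have u4v: "u ^ 4 * v = fps_const (s ^ 4 * t) * fps_X ^ (2 * B * (a + c))"
    using mono[of 4 1] by (simp add: a algebra_simps)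
  have QQ: "(fps_const (s\<^sup>2 * t) * fps_X ^ (2 * B * a))\<^sup>2 = fps_const (s ^ 4 * t\<^sup>2) * fps_X ^ (4 * B * a)"
    unfolding power_mult_distrib fps_const_power by (simp add: power_mult_distrib flip: power_mult)
  have al: "(alt j :: 'a fps) = fps_const (alt j)" for j by (simp add: alt_def)
  have "(u\<^sup>2 * v) $ 0 = 0" unfolding Q using assms by simp
  from quintuple_product[OF this] show ?thesis
    unfolding Q QQ u4v uv unfolding mono al fps_const_mult mult.assoc[symmetric]
    unfolding u_def v_def .
qed

lemma alt_eqI: "even (j - k) \<Longrightarrow> alt j = alt k"
  by (auto simp: alt_def)

lemma alt_eq_uminusI: "odd (j - k) \<Longrightarrow> alt j = - alt k"
  by (auto simp: alt_def)

lemma alt_power_int: "(- 1) powi k = (alt k :: rat)"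
  by (cases "even k") (simp_all add: alt_def)

lemma minus_one_power_alt: "(- 1) ^ n = (alt (int n) :: 'a::comm_ring_1)"
  using minus_power_alt[of "1 :: 'a" n] by simp

text \<open>
  The signs that come from \<open>t = -1\<close> are those of the pentagonal numbers. Their behaviour under
  the shifts by 4 and by 2 and under the reflection \<open>k \<mapsto> 1 - k\<close> decides the last two identities.
\<close>

lemma alt_pent_add_4: "alt (int (pent (k + 4 * m))) = alt (int (pent k))"
proof (rule alt_eqI)
  have "int (pent (k + 4 * m)) - int (pent k) = 2 * (6 * k * m + 12 * m\<^sup>2 + m)"
    using two_pent[of "k + 4 * m"] two_pent[of k] by (simp add: algebra_simps power2_eq_square)
  then show "even (int (pent (k + 4 * m)) - int (pent k))" by simp
qed

lemma alt_pent_add_2: "alt (int (pent (k + 2))) = - alt (int (pent k))"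
proof (rule alt_eq_uminusI)
  have "int (pent (k + 2)) - int (pent k) = 2 * (3 * k + 3) + 1"
    using two_pent[of "k + 2"] two_pent[of k] by (simp add: algebra_simps)
  then show "odd (int (pent (k + 2)) - int (pent k))" by simp
qed

lemma alt_pent_reflect: "alt (int (pent (1 - k))) = alt (int (pent k))"
proof (rule alt_eqI)
  have "int (pent (1 - k)) - int (pent k) = 2 * (1 - 2 * k)"
    using two_pent[of "1 - k"] two_pent[of k] by (simp add: algebra_simps)
  then show "even (int (pent (1 - k)) - int (pent k))" by simp
qed

lemma alt_triangular: "alt (k * (k - 1) div 2) = alt (int (pent k))"
  "alt (k * (k + 1) div 2) = alt k * alt (int (pent k))"
proof -
  have h: "2 * (k * (k - 1) div 2) = k * (k - 1)" "2 * (k * (k + 1) div 2) = k * (k + 1)" by simp_all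
  have "k * (k - 1) div 2 - int (pent k) = - (k * (k + 1))"
    using two_pent[of k] h(1) by (simp add: algebra_simps)
  then show "alt (k * (k - 1) div 2) = alt (int (pent k))" by (intro alt_eqI) simp
  have "k * (k + 1) div 2 - (k + int (pent k)) = - (k * (k + 1))"
    using two_pent[of k] h(2) by (simp add: algebra_simps)
  then show "alt (k * (k + 1) div 2) = alt k * alt (int (pent k))"
    unfolding alt_add[symmetric] by (intro alt_eqI) simp
qed

lemma alt_exponents:
  "(- 1) ^ nat (3 * j\<^sup>2 - 2 * j) = (alt j :: 'a::comm_ring_1)"
  "(- 1) ^ nat (3 * j\<^sup>2 + 4 * j + 1) = - (alt j :: 'a)"
  unfolding minus_one_power_alt using quintuple_exponents_nonneg[of j] by (simp_all add: alt_def)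

theorem theorem3p10:
  fixes p p' a' b b' c B n :: nat
  assumes "coprime p p'" and "p > 1" and "p' > 1"
    and "a' > 0" and "b > 0" and "b' > 0" and "a' > c"
    and "3 * b dvd p" and "a' * b' dvd p'"
    and "B = b * b'" and "n = p * p' div (3 * a' * b * b')" and "even n"
  shows
    "(even (p' div b') \<or> even (p div b) \<and> odd c \<longrightarrow>
      rser_of_fps
        (qpoch [- (fps_X ^ (B * c)), - (fps_X ^ (B * (2 * a' - c))), fps_X ^ (2 * B * a')]
               (fps_X ^ (2 * B * a'))
         * qpoch [fps_X ^ (2 * B * (a' + c)), fps_X ^ (2 * B * (a' - c))] (fps_X ^ (4 * B * a'))
         / qpoch [fps_X ^ n] (fps_X ^ n))
      = character_sum (\<lambda>f. f) n p p' a' b b' c)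
   \<and> (4 dvd n \<and> (4 dvd p' div b' \<or> 4 dvd p div b \<and> 4 dvd c) \<longrightarrow>
      rser_of_fps
        (qpoch [fps_X ^ (B * c), - (fps_X ^ (B * (2 * a' - c))), - (fps_X ^ (2 * B * a'))]
               (- (fps_X ^ (2 * B * a')))
         * qpoch [- (fps_X ^ (2 * B * (a' + c))), - (fps_X ^ (2 * B * (a' - c)))]
                 (fps_X ^ (4 * B * a'))
         / qpoch [fps_X ^ n] (fps_X ^ n))
      = character_sum (\<lambda>f. f * (f - 1) div 2) n p p' a' b b' c)
   \<and> (4 dvd n \<and> (4 dvd p' div b' \<or> 4 dvd p div b \<and> 4 dvd c + 2) \<longrightarrow>
      rser_of_fps
        (qpoch [- (fps_X ^ (B * c)), fps_X ^ (B * (2 * a' - c)), - (fps_X ^ (2 * B * a'))]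
               (- (fps_X ^ (2 * B * a')))
         * qpoch [- (fps_X ^ (2 * B * (a' + c))), - (fps_X ^ (2 * B * (a' - c)))]
                 (fps_X ^ (4 * B * a'))
         / qpoch [fps_X ^ n] (fps_X ^ n))
      = character_sum (\<lambda>f. f * (f + 1) div 2) n p p' a' b b' c)"
proof -
  obtain P0 where P0: "p = 3 * b * P0" using assms(8) by blast
  obtain P0' where P0': "p' = a' * b' * P0'" using assms(9) by blast
  have P: "p div b = 3 * P0" and P': "p' div b' = a' * P0'"
    using assms(5,6) by (simp_all add: P0 P0')
  have n: "n = P0 * P0'"
  proof -
    have "p * p' = (3 * a' * b * b') * (P0 * P0')" by (simp add: P0 P0' ac_simps)
    then show ?thesis using assms(4-6,11) by simp
  qed
  have cop: "coprime P0 P0'" "coprime P0 a'" using assms(1) by (simp_all add: P0 P0')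
  have B: "B > 0" using assms(5,6,10) by simp
  have n0: "n > 0" using assms(2,3) by (auto simp: n P0 P0' intro!: gr0I)
  note sum_eq = character_sum_eq_signed_theta[OF assms(1-11)]
  have divide: "rser_of_fps (F / qpoch [fps_X ^ n] (fps_X ^ n)) =
      rser_of_fps (inverse (qpoch [fps_X ^ n] (fps_X ^ n))) * rser_of_fps F" for F :: "rat fps"
    using n0 by (simp add: fps_divide_unit qpoch_singleton_nth_0 rser_of_fps_mult mult.commute)
  have m1: "fps_const (- 1 :: rat) * F = - F" for F by (simp flip: fps_const_neg)
  have r: "int P0' * r = 6 * k + 1 + 3 * t" if "int (p' div b') * r = int a' * (6 * k + 1 + 3 * t)" for r k t
    using that assms(4) by (simp add: P')
  have s: "int P0 * s = int c + int a' * t" if "int (p div b) * s = 3 * (int c + int a' * t)" for s t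
    using that by (simp add: P)
  have z: "int P0' dvd 6 * i + 1" if "int (p' div b') dvd int a' * (6 * i + 1)" for i
    using that assms(4) by (simp add: P')
  have odd: "odd P0 \<or> odd (a' * P0')"
  proof -
    have "coprime P0 (a' * P0')" using cop by simp
    then show ?thesis using coprime_common_divisor[of P0 "a' * P0'" 2] by auto
  qed
  have cop4: "coprime 4 x" if "odd x" for x :: nat
    using that coprime_power_left_iff[of 2 2 x] by simp
  have four: "4 dvd P0'" if "4 dvd n" "4 dvd p' div b'"
  proof -
    have "even (a' * P0')" using that(2) unfolding P' by presburger
    then have "coprime 4 P0" using odd cop4 by blast
    then show ?thesis using that(1) unfolding n by (simp only: coprime_dvd_mult_right_iff)
  qed
  have four_t: "4 dvd P0" "odd a'" if "4 dvd p div b"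
  proof -
    have "coprime 4 (3 :: nat)" by (rule cop4) simp
    then show "4 dvd P0" using that unfolding P by (simp only: coprime_dvd_mult_right_iff)
    then have "even P0" by presburger
    then show "odd a'" using odd by simp
  qed
  have n4: "k + int n * j = k + 4 * (int (n div 4) * j)" if "4 dvd n" for k j
    using that by (auto elim!: dvdE)
  show ?thesis
  proof (intro conjI impI)
    assume A: "even (p' div b') \<or> even (p div b) \<and> odd c"
    show "rser_of_fps
        (qpoch [- (fps_X ^ (B * c)), - (fps_X ^ (B * (2 * a' - c))), fps_X ^ (2 * B * a')]
               (fps_X ^ (2 * B * a'))
         * qpoch [fps_X ^ (2 * B * (a' + c)), fps_X ^ (2 * B * (a' - c))] (fps_X ^ (4 * B * a'))
         / qpoch [fps_X ^ n] (fps_X ^ n))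
      = character_sum (\<lambda>f. f) n p p' a' b b' c"
    proof -
      have eP': "even P0'" if "even (p' div b')"
      proof -
        have "odd P0" using that odd unfolding P' by blast
        then show ?thesis using assms(12) by (simp add: n)
      qed
      have "character_sum (\<lambda>f. f) n p p' a' b b' c =
        rser_of_fps (inverse (qpoch [fps_X ^ n] (fps_X ^ n))) * rser_of_fps
          (formal_sum (\<lambda>j. fps_const (alt j) * fps_X ^ (B * c * nat (3 * j\<^sup>2 - 2 * j) + 2 * B * (a' - c) * pent j)) UNIV +
           formal_sum (\<lambda>j. fps_const (alt j) * fps_X ^ (B * c * nat (3 * j\<^sup>2 + 4 * j + 1) + 2 * B * (a' - c) * pent j)) UNIV)"
      proof (rule sum_eq)
        show "(- 1) powi f = (alt f :: rat)" for f by (rule alt_power_int)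
        show "(alt (k + int n * j) :: rat) = alt k" for k j using assms(12) by (intro alt_eqI) simp
        then show "(alt (k + int n * j) :: rat) = alt k" for k j .
        fix k t r' s' :: int
        assume "int (p' div b') * r' = int a' * (6 * k + 1 + 3 * t)"
          and "int (p div b) * s' = 3 * (int c + int a' * t)"
        then have 1: "int P0' * r' = 6 * k + 1 + 3 * t" and 2: "int P0 * s' = int c + int a' * t"
          using r s by blast+
        \<comment> \<open>both kinds of terms carry the sign \<open>(-1)\<^sup>k\<close>, so \<open>t\<close> has to be odd\<close>
        have "odd t"
        proof (cases "even (p' div b')")
          case True
          then have "even (int P0' * r')" using eP' by simp
          then show ?thesis unfolding 1 by presburger
        next
          case False
          then have "even (int P0 * s')" "odd c" "odd a'" using A by (auto simp: P P')
          then show ?thesis unfolding 2 by simp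
        qed
        then show "(alt (k + t) :: rat) = - alt k" by (intro alt_eq_uminusI) simp
      next
        fix k i :: int
        assume "c = 0" and "int (p' div b') dvd int a' * (6 * i + 1)"
        then have "int P0' dvd 6 * i + 1" "even P0'" using z eP' A by auto
        then have "even (6 * i + 1)" by (meson dvd_trans even_of_nat)
        then show "(alt k :: rat) = - alt k" by simp
      qed
      then show ?thesis
        using quintuple_product_monomials[OF assms(7) B, of "1 :: rat" 1] by (simp add: divide)
    qed
  next
    assume A: "4 dvd n \<and> (4 dvd p' div b' \<or> 4 dvd p div b \<and> 4 dvd c)"
    show "rser_of_fps
        (qpoch [fps_X ^ (B * c), - (fps_X ^ (B * (2 * a' - c))), - (fps_X ^ (2 * B * a'))]
               (- (fps_X ^ (2 * B * a')))
         * qpoch [- (fps_X ^ (2 * B * (a' + c))), - (fps_X ^ (2 * B * (a' - c)))]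
                 (fps_X ^ (4 * B * a'))
         / qpoch [fps_X ^ n] (fps_X ^ n))
      = character_sum (\<lambda>f. f * (f - 1) div 2) n p p' a' b b' c"
    proof -
      have per: "alt (int (pent (k + int n * j))) = (alt (int (pent k)) :: rat)" for k j
        using A by (simp only: n4 alt_pent_add_4)
      have "character_sum (\<lambda>f. f * (f - 1) div 2) n p p' a' b b' c =
        rser_of_fps (inverse (qpoch [fps_X ^ n] (fps_X ^ n))) * rser_of_fps
          (formal_sum (\<lambda>j. fps_const (alt (int (pent j))) * fps_X ^ (B * c * nat (3 * j\<^sup>2 - 2 * j) + 2 * B * (a' - c) * pent j)) UNIV +
           formal_sum (\<lambda>j. fps_const (- alt (int (pent j))) * fps_X ^ (B * c * nat (3 * j\<^sup>2 + 4 * j + 1) + 2 * B * (a' - c) * pent j)) UNIV)"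
      proof (rule sum_eq)
        show "(- 1) powi (f * (f - 1) div 2) = (alt (int (pent f)) :: rat)" for f
          unfolding alt_power_int by (rule alt_triangular)
        show "alt (int (pent (k + int n * j))) = (alt (int (pent k)) :: rat)"
          "- alt (int (pent (k + int n * j))) = - (alt (int (pent k)) :: rat)" for k j
          by (simp_all only: per)
        fix k t r' s' :: int
        assume "int (p' div b') * r' = int a' * (6 * k + 1 + 3 * t)"
          and "int (p div b) * s' = 3 * (int c + int a' * t)"
        then have 1: "int P0' * r' = 6 * k + 1 + 3 * t" and 2: "int P0 * s' = int c + int a' * t"
          using r s by blast+
        \<comment> \<open>the terms of the second kind carry the opposite sign already, so the sign of the
          pentagonal number must not change\<close>
        have "(\<exists>m. k + t = (1 - k) + 4 * m) \<or> (\<exists>m. k + t = k + 4 * m)"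
        proof (cases "4 dvd p' div b'")
          case True
          then have "4 dvd int P0'" using A four by presburger
          then have "4 dvd 6 * k + 1 + 3 * t" unfolding 1[symmetric] by (rule dvd_mult2)
          then show ?thesis by presburger
        next
          case False
          then have *: "4 dvd int P0" "odd a'" "4 dvd int c" using A four_t by presburger+
          have "4 dvd int c + int a' * t" unfolding 2[symmetric] using *(1) by (rule dvd_mult2)
          then have "4 dvd int a' * t" using *(3) by (simp add: dvd_add_right_iff)
          moreover have "coprime 4 (int a')" using cop4[OF *(2)] coprime_int_iff[of 4 a'] by simp
          ultimately have "4 dvd t" by (simp only: coprime_dvd_mult_right_iff)
          then show ?thesis by presburger
        qed
        then show "- alt (int (pent (k + t))) = - (alt (int (pent k)) :: rat)"
          using alt_pent_add_4 alt_pent_reflect by metis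
      qed simp
      moreover have "alt j * (- 1) ^ nat (3 * j\<^sup>2 - 2 * j) * (- 1) ^ pent j = (alt (int (pent j)) :: rat)"
        "alt j * (- 1) ^ nat (3 * j\<^sup>2 + 4 * j + 1) * (- 1) ^ pent j = (- alt (int (pent j)) :: rat)" for j
        unfolding alt_exponents minus_one_power_alt[of "pent j"] by (simp_all add: alt_def)
      ultimately show ?thesis
        using quintuple_product_monomials[OF assms(7) B, of "- 1 :: rat" "- 1"]
        by (simp add: divide m1)
    qed
  next
    assume A: "4 dvd n \<and> (4 dvd p' div b' \<or> 4 dvd p div b \<and> 4 dvd c + 2)"
    show "rser_of_fps
        (qpoch [- (fps_X ^ (B * c)), fps_X ^ (B * (2 * a' - c)), - (fps_X ^ (2 * B * a'))]
               (- (fps_X ^ (2 * B * a')))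
         * qpoch [- (fps_X ^ (2 * B * (a' + c))), - (fps_X ^ (2 * B * (a' - c)))]
                 (fps_X ^ (4 * B * a'))
         / qpoch [fps_X ^ n] (fps_X ^ n))
      = character_sum (\<lambda>f. f * (f + 1) div 2) n p p' a' b b' c"
    proof -
      let ?\<epsilon> = "\<lambda>j. alt j * alt (int (pent j)) :: rat"
      have add4: "?\<epsilon> (k + 4 * m) = ?\<epsilon> k" for k m
        unfolding alt_pent_add_4 by (simp add: alt_def)
      have per: "?\<epsilon> (k + int n * j) = ?\<epsilon> k" for k j
        using A by (simp only: n4 add4)
      have reflect: "?\<epsilon> (1 - k) = - ?\<epsilon> k" for k
        unfolding alt_pent_reflect by (simp add: alt_def)
      have add2: "?\<epsilon> (k + 2) = - ?\<epsilon> k" for k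
        unfolding alt_pent_add_2 by (simp add: alt_def)
      have "character_sum (\<lambda>f. f * (f + 1) div 2) n p p' a' b b' c =
        rser_of_fps (inverse (qpoch [fps_X ^ n] (fps_X ^ n))) * rser_of_fps
          (formal_sum (\<lambda>j. fps_const (?\<epsilon> j) * fps_X ^ (B * c * nat (3 * j\<^sup>2 - 2 * j) + 2 * B * (a' - c) * pent j)) UNIV +
           formal_sum (\<lambda>j. fps_const (?\<epsilon> j) * fps_X ^ (B * c * nat (3 * j\<^sup>2 + 4 * j + 1) + 2 * B * (a' - c) * pent j)) UNIV)"
      proof (rule sum_eq)
        show "(- 1) powi (f * (f + 1) div 2) = ?\<epsilon> f" for f
          unfolding alt_power_int by (rule alt_triangular)
        show "?\<epsilon> (k + int n * j) = ?\<epsilon> k" "?\<epsilon> (k + int n * j) = ?\<epsilon> k" for k j by (rule per)+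
        fix k t r' s' :: int
        assume "int (p' div b') * r' = int a' * (6 * k + 1 + 3 * t)"
          and "int (p div b) * s' = 3 * (int c + int a' * t)"
        then have 1: "int P0' * r' = 6 * k + 1 + 3 * t" and 2: "int P0 * s' = int c + int a' * t"
          using r s by blast+
        \<comment> \<open>here the sign has to change, which the reflection does because it changes the parity
          of the index, and the shift by 2 because it changes that of the pentagonal number\<close>
        have "(\<exists>m. k + t = (1 - k) + 4 * m) \<or> (\<exists>m. k + t = (k + 2) + 4 * m)"
        proof (cases "4 dvd p' div b'")
          case True
          then have "4 dvd int P0'" using A four by presburger
          then have "4 dvd 6 * k + 1 + 3 * t" unfolding 1[symmetric] by (rule dvd_mult2)
          then show ?thesis by presburger
        next
          case False
          then have *: "4 dvd int P0" "odd a'" "4 dvd int c + 2" using A four_t by presburger+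
          have "4 dvd int c + int a' * t" unfolding 2[symmetric] using *(1) by (rule dvd_mult2)
          \<comment> \<open>for odd \<open>a'\<close> the last subtrahend is \<open>2 a' - 2\<close>, and \<open>a' (t - 2)\<close> is what remains\<close>
          then have "4 dvd (int c + int a' * t) - (int c + 2) - 4 * (int a' div 2)" using *(3) by (intro dvd_diff) simp_all
          also have "(int c + int a' * t) - (int c + 2) - 4 * (int a' div 2) = int a' * (t - 2)"
            using *(2) by (auto elim!: oddE simp: algebra_simps)
          finally have "4 dvd int a' * (t - 2)" .
          moreover have "coprime 4 (int a')" using cop4[OF *(2)] coprime_int_iff[of 4 a'] by simp
          ultimately have "4 dvd t - 2" by (simp only: coprime_dvd_mult_right_iff)
          then show ?thesis by presburger
        qed
        then show "?\<epsilon> (k + t) = - ?\<epsilon> k"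
          using add4 add2 reflect by metis
      next
        fix k i :: int
        assume c: "c = 0" and "int (p' div b') dvd int a' * (6 * i + 1)"
        then have i: "int P0' dvd 6 * i + 1" using z by blast
        have "4 dvd p' div b'"
        proof -
          have "\<not> 4 dvd c + 2" unfolding c by presburger
          then show ?thesis using A by blast
        qed
        then have "4 dvd P0'" using A four by blast
        then have "even P0'" by presburger
        then have "even (6 * i + 1)" using i by (meson dvd_trans even_of_nat)
        then show "?\<epsilon> k = - ?\<epsilon> k" by simp
      qed
      moreover have "(- 1) ^ pent j = (alt (int (pent j)) :: rat)" for j
        by (rule minus_one_power_alt)
      ultimately show ?thesis
        using quintuple_product_monomials[OF assms(7) B, of "1 :: rat" "- 1"]
        by (simp add: divide m1)
    qed
  qed
qed

end
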